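(* There exist absolute real constants $c_3\in[2.427,2.428)$, $c_4\in[3.461,3.462)$ and $c_5\in[4.993,4.994)$ (i.e. $c_3=2.427\ldots$, $c_4=3.461\ldots$, $c_5=4.993\ldots$) such that for every $f\in\mathcal{S}_b$ with Taylor expansion $f(z)=z+a_2z^2+a_3z^3+\cdots$ in $\mathbb{D}$ one has (i) $|a_3|\le c_3$, (ii) $|a_4|\le c_4$, (iii) $|a_5|\le c_5$.
   Context: Let $\mathbb{D}=\{z\in\mathbb{C}:|z|<1\}$. $\mathcal{S}$ is the class of functions $f$ that are analytic and univalent (injective) in $\mathbb{D}$ with expansion $f(z)=z+a_2z^2+a_3z^3+\cdots$. $\mathcal{S}_b\subset\mathcal{S}$ is the class of (normalized) bi-univalent functions: those $f\in\mathcal{S}$ whose inverse function $f^{-1}$ is also univalent in $\mathbb{D}$, meaning that the inverse of $f$ near the origin (with $f^{-1}(0)=0$) extends to an analytic univalent function on $\mathbb{D}$. (For example $z$, $z/(1-z)$ and $\frac12\log\frac{1+z}{1-z}$ belong to $\mathcal{S}_b$.) *)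

theory Defs
  imports "HOL-Complex_Analysis.Complex_Analysis"
begin

definition univalent_on :: "(complex \<Rightarrow> complex) \<Rightarrow> complex set \<Rightarrow> bool" where
  "univalent_on f A \<longleftrightarrow> f holomorphic_on A \<and> inj_on f A"

definition class_S :: "(complex \<Rightarrow> complex) set" where
  "class_S = {f. univalent_on f (ball 0 1) \<and> f 0 = 0 \<and> deriv f 0 = 1}"

(* The function g below is the analytic univalent extension to the unit disc of the germ
   of the inverse of f at the origin. Agreement with the inverse is required only near 0,
   because the intersection of the unit disc with the image of f need not be connected. *)

definition class_Sb :: "(complex \<Rightarrow> complex) set" where
  "class_Sb = {f \<in> class_S. \<exists>g. univalent_on g (ball 0 1) \<and>
                 (\<forall>\<^sub>F w in nhds 0. g w = inv_into (ball 0 1) f w)}"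

end

theory Submission
  imports Defs
begin

text \<open>
  Write \<open>f = z s\<^sup>2\<close> with \<open>s(0) = 1\<close>. For a polynomial \<open>q\<close> the circular means of \<open>ln \<bar>q(1/f)\<bar>\<close> decrease with
  the radius, because \<open>1 - y f\<close> has at most one zero, which is simple. Averaging over the target plane,
  the means of \<open>\<bar>q(1/f)\<bar>\<close> decrease as well. If \<open>q(1/f) = z\<^bsup>-N\<^esup> K\<^sup>2\<close> with \<open>K\<close> holomorphic, then Parseval
  turns this into the area inequality \<open>\<Sum> (2m - N) \<bar>K\<^sub>m\<bar>\<^sup>2 \<le> 0\<close>, applied here to
  \<open>K = x\<^sub>1 z/s + x\<^sub>3/s\<^sup>3\<close>.

  The inequality for \<open>K = z/s\<close> bounds \<open>a\<^sub>3, a\<^sub>4, a\<^sub>5\<close> as soon as \<open>\<bar>a\<^sub>2\<bar> \<le> 1.48\<close>. To prove the latter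
  for bi-univalent \<open>f\<close>, one rescales to \<open>a\<^sub>2 = 1.48\<close> (the pair \<open>f(cz)/c\<close>, \<open>g(cz)/c\<close> is again admissible)
  and adds the inequalities for \<open>f\<close> and for its inverse \<open>g\<close>, with \<open>x\<^sub>3 = 3/10\<close> and \<open>x\<^sub>3 = -3/10\<close>
  respectively. All coefficients up to \<open>z\<^sup>7\<close> enter, and the sum turns out to be positive.
\<close>

section \<open>Circular means of logarithms\<close>

text \<open>No single function of the class suffices: the rescaled Koebe function lies in
  \<open>class_S\<close> and has second coefficient 1.48. What excludes this value for a pair is
  that the coefficients of g are polynomials in those of f, so both area inequalities constrain the
  same unknowns and only their sum is contradictory. The shape of K comes from the odd function F(z)
  = z s(z^2), a square root of f(z^2): z^(-3) K(z^2) = x1/F + x3/F^3, and the weights 2m - 3 are the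
  exponents of its Laurent series. The opposite signs of x3 come from the involution replacing f by
  -g(-z). It turns K for f with x3 = 3/10 into -K(-z) for g with x3 = -3/10, so the two inequalities
  are exchanged and their sum is symmetric. The area inequality is obtained without boundary curves
  or Green's theorem; univalence enters only through the number of zeros of 1 - y f and their
  multiplicity.\<close>

definition circ :: "real measure" where
  "circ = restrict_space lborel {0..1}"

definition turn :: "real \<Rightarrow> complex" where
  "turn t = cis (2 * pi * t)"

lemma norm_turn [simp]: "cmod (turn t) = 1"
  by (simp add: turn_def)

lemma turn_nonzero [simp]: "turn t \<noteq> 0"
  using norm_turn[of t] by (metis norm_zero zero_neq_one)

lemma continuous_on_turn [continuous_intros]: "continuous_on A turn"
  unfolding turn_def by (intro continuous_intros)

lemma measurable_turn [measurable]: "turn \<in> borel_measurable borel"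
  by (intro borel_measurable_continuous_onI continuous_on_turn)

lemma space_circ [simp]: "space circ = {0..1}"
  by (simp add: circ_def)

lemma measurable_circI [measurable (raw)]:
  "f \<in> measurable borel N \<Longrightarrow> f \<in> measurable circ N"
  unfolding circ_def by (rule measurable_restrict_space1) simp

lemma emeasure_circ_space: "emeasure circ {0..1} = 1"
  by (simp add: circ_def emeasure_restrict_space)

interpretation circ: finite_measure circ
  by standard (simp add: emeasure_circ_space)

lemma measure_circ_space [simp]: "measure circ {0..1} = 1"
  by (simp add: measure_def emeasure_circ_space)

lemma integrable_circ_continuous:
  fixes h :: "real \<Rightarrow> 'a::euclidean_space"
  assumes "continuous_on UNIV h"
  shows "integrable circ h"
proof -
  have "bounded (h ` {0..1})"
    by (intro compact_imp_bounded compact_continuous_image continuous_on_subset[OF assms]) auto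
  then obtain B where "\<And>t. t \<in> {0..1} \<Longrightarrow> norm (h t) \<le> B"
    unfolding bounded_iff by blast
  then show ?thesis
    by (intro circ.integrable_const_bound[where B = B] AE_I2)
       (auto intro!: measurable_circI borel_measurable_continuous_onI assms)
qed

lemma integral_circ_eq:
  fixes h :: "real \<Rightarrow> 'a::euclidean_space"
  assumes "integrable circ h"
  shows "integral\<^sup>L circ h = integral {0..1} h"
proof -
  have "set_integrable lborel {0..1} h"
    using assms unfolding circ_def set_integrable_def by (subst (asm) integrable_restrict_space) auto
  from set_borel_integral_eq_integral(2)[OF this] show ?thesis
    by (simp add: circ_def integral_restrict_space set_lebesgue_integral_def)
qed

lemma circ_mean_value:
  assumes h: "h holomorphic_on ball 0 R" and r: "0 < r" "r < R"
  shows "has_bochner_integral circ (\<lambda>t. h (of_real r * turn t)) (h 0)"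
proof -
  have cont: "continuous_on UNIV (\<lambda>t. h (of_real r * turn t))"
  proof (rule continuous_on_compose2[of "ball 0 R" h])
    show "continuous_on UNIV (\<lambda>t. of_real r * turn t)"
      by (intro continuous_intros)
  qed (use r holomorphic_on_imp_continuous_on[OF h] in \<open>auto simp: norm_mult\<close>)
  have int: "integrable circ (\<lambda>t. h (of_real r * turn t))"
    by (rule integrable_circ_continuous[OF cont])
  have "((\<lambda>u. h u / (u - 0)) has_contour_integral (2 * of_real pi * \<i> * h 0)) (circlepath 0 r)"
    by (rule Cauchy_integral_circlepath_simple) (use r in \<open>auto intro!: holomorphic_on_subset[OF h]\<close>)
  then have "((\<lambda>t. h (circlepath 0 r t) / circlepath 0 r t * vector_derivative (circlepath 0 r) (at t))
      has_integral (2 * of_real pi * \<i> * h 0)) {0..1}"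
    by (simp add: has_contour_integral)
  then have "((\<lambda>t. 2 * of_real pi * \<i> * h (of_real r * turn t))
      has_integral (2 * of_real pi * \<i> * h 0)) {0..1}"
  proof (rule has_integral_eq[rotated])
    fix t :: real
    have "circlepath 0 r t = of_real r * turn t"
      by (simp add: circlepath turn_def cis_conv_exp algebra_simps)
    moreover have "vector_derivative (circlepath 0 r) (at t) = 2 * pi * \<i> * (of_real r * turn t)"
      by (simp add: vector_derivative_circlepath turn_def cis_conv_exp algebra_simps)
    ultimately show "h (circlepath 0 r t) / circlepath 0 r t * vector_derivative (circlepath 0 r) (at t)
        = 2 * of_real pi * \<i> * h (of_real r * turn t)"
      using r by simp
  qed
  then have "((\<lambda>t. inverse (2 * of_real pi * \<i>) * (2 * of_real pi * \<i> * h (of_real r * turn t)))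
      has_integral (inverse (2 * of_real pi * \<i>) * (2 * of_real pi * \<i> * h 0))) {0..1}"
    by (rule has_integral_mult_right)
  then have "((\<lambda>t. h (of_real r * turn t)) has_integral h 0) {0..1}"
    by (simp add: field_simps)
  with int show ?thesis
    by (simp add: has_bochner_integral_iff integral_circ_eq integral_unique)
qed

lemma holomorphic_log_ball:
  assumes "h holomorphic_on ball 0 R" "\<And>z. z \<in> ball 0 R \<Longrightarrow> h z \<noteq> 0"
  shows "\<exists>g. g holomorphic_on ball 0 R \<and> (\<forall>z\<in>ball 0 R. h z = exp (g z))"
  using simply_connected_eq_holomorphic_log[of "ball 0 R"] assms
  by (auto simp: convex_imp_simply_connected)

text \<open>The logarithm of the modulus is the real part of a holomorphic logarithm, so the mean
  value property applies.\<close>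

lemma circ_mean_ln_nonvanishing:
  assumes h: "h holomorphic_on ball 0 R" and nz: "\<And>z. z \<in> ball 0 R \<Longrightarrow> h z \<noteq> 0"
    and r: "0 < r" "r < R"
  shows "has_bochner_integral circ (\<lambda>t. ln (cmod (h (of_real r * turn t)))) (ln (cmod (h 0)))"
proof -
  obtain g where g: "g holomorphic_on ball 0 R" "\<And>z. z \<in> ball 0 R \<Longrightarrow> h z = exp (g z)"
    using holomorphic_log_ball[OF h nz] by blast
  have "has_bochner_integral circ (\<lambda>t. Re (g (of_real r * turn t))) (Re (g 0))"
    by (rule has_bochner_integral_Re[OF circ_mean_value[OF g(1) r]])
  moreover have "ln (cmod (h (of_real r * turn t))) = Re (g (of_real r * turn t))" for t
    using r by (subst g(2)) (auto simp: norm_mult)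
  moreover have "ln (cmod (h 0)) = Re (g 0)"
    using r by (subst g(2)) auto
  ultimately show ?thesis by simp
qed

text \<open>The parameters hitting a given point lie in a single translate of the integers, hence
  form a null set. This discards zeros on the circle, where the convention \<open>ln 0 = 0\<close>
  would break additivity.\<close>

lemma AE_circ_turn_neq: "AE t in circ. of_real r * turn t \<noteq> a" if "r > 0"
proof -
  have "countable {t. of_real r * turn t = a}"
  proof (cases "\<exists>t0. of_real r * turn t0 = a")
    case True
    then obtain t0 where t0: "of_real r * turn t0 = a" by blast
    have "t \<in> range (\<lambda>n::int. t0 + of_int n)" if "of_real r * turn t = a" for t
    proof -
      have "of_real r * turn t = of_real r * turn t0" using that t0 by simp
      then have eq: "turn t = turn t0" using \<open>r > 0\<close> by simp
      have "sin (2 * pi * t) = sin (2 * pi * t0)" "cos (2 * pi * t) = cos (2 * pi * t0)"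
        using arg_cong[OF eq, of Im] arg_cong[OF eq, of Re] by (simp_all add: turn_def)
      then obtain n :: int where "2 * pi * t = 2 * pi * t0 + 2 * pi * n"
        using iffD1[OF sin_cos_eq_iff[of "2 * pi * t" "2 * pi * t0"]] by blast
      then have "2 * pi * t = 2 * pi * (t0 + n)" by (simp only: distrib_left)
      then have "t = t0 + n" by simp
      then show ?thesis by blast
    qed
    then have "{t. of_real r * turn t = a} \<subseteq> range (\<lambda>n::int. t0 + of_int n)" by blast
    then show ?thesis by (rule countable_subset) simp
  next
    case False
    then show ?thesis by simp
  qed
  then have "{t. of_real r * turn t = a} \<in> null_sets lborel"
    by (rule countable_imp_null_set_lborel)
  from AE_not_in[OF this] have "AE t in lborel. of_real r * turn t \<noteq> a" by simp
  then show ?thesis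
    unfolding circ_def by (subst AE_restrict_space_iff) auto
qed

text \<open>The singular case of Jensen's formula: the zero lies on the circle of integration. It is
  approached along the radius from inside, where the mean is already 0.\<close>

lemma circ_mean_ln_unit:
  assumes b: "cmod b = 1"
  shows "has_bochner_integral circ (\<lambda>t. ln (cmod (turn t - b))) 0"
proof -
  \<comment> \<open>The double \<open>Suc\<close> keeps \<open>s 0\<close> positive, so that
    \<open>1 / s n\<close> makes sense as a radius below.\<close>
  define s :: "nat \<Rightarrow> real" where "s n = 1 + - inverse (real (Suc (Suc n)))" for n
  have s01: "0 < s n" "s n < 1" for n by (auto simp: s_def field_simps)
  have slim: "s \<longlonglongrightarrow> 1"
    unfolding s_def by (rule LIMSEQ_Suc[OF LIMSEQ_inverse_real_of_nat_add_minus])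
  \<comment> \<open>The factor 2 bounds the distance of two points of the closed disc, so the
    integrands are nonnegative and Fatou's lemma is available. At the pole of \<open>Y\<close> the
    conventions for division by 0 and \<open>ln 0\<close> give the value 0.\<close>
  define X where "X n t = ln (2 / cmod (turn t - of_real (s n) * b))" for n t
  define Y where "Y t = ln (2 / cmod (turn t - b))" for t
  have pos: "cmod (turn t - of_real (s n) * b) > 0" for n t
  proof -
    have "cmod (turn t - of_real (s n) * b) \<ge> cmod (turn t) - cmod (of_real (s n) * b)"
      by (rule norm_triangle_ineq2)
    then have "1 - s n \<le> cmod (turn t - of_real (s n) * b)"
      using s01[of n] b by (simp add: norm_mult)
    with s01(2)[of n] show ?thesis by linarith
  qed
  have le2: "cmod (turn t - of_real (s n) * b) \<le> 2" for n t
    using norm_triangle_ineq4[of "turn t" "of_real (s n) * b"] s01[of n] b by (simp add: norm_mult)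
  have hX: "has_bochner_integral circ (X n) (ln 2)" for n
  proof -
    \<comment> \<open>On the unit circle this function has the same modulus as z - s b, but its zero
      is reflected to b / s outside the closed disc.\<close>
    have "has_bochner_integral circ (\<lambda>t. ln (cmod ((\<lambda>z. 1 - of_real (s n) * cnj b * z) (of_real 1 * turn t))))
        (ln (cmod ((\<lambda>z. 1 - of_real (s n) * cnj b * z) 0)))"
    proof (rule circ_mean_ln_nonvanishing[where R = "1 / s n"])
      fix z :: complex assume z: "z \<in> ball 0 (1 / s n)"
      have "cmod (of_real (s n) * cnj b * z) < 1"
        using z s01[of n] b by (simp add: norm_mult field_simps)
      then show "1 - of_real (s n) * cnj b * z \<noteq> 0"
        by (metis eq_iff_diff_eq_0 less_irrefl norm_one)
    qed (use s01[of n] in \<open>auto intro!: holomorphic_intros simp: field_simps\<close>)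
    moreover have "cmod (1 - of_real (s n) * cnj b * turn t) = cmod (turn t - of_real (s n) * b)" for t
    proof -
      have "cmod (1 - of_real (s n) * cnj b * turn t) = cmod (cnj (1 - of_real (s n) * cnj b * turn t))"
        by (simp only: complex_mod_cnj)
      also have "\<dots> = cmod (turn t) * cmod (1 - of_real (s n) * b * cnj (turn t))"
        by simp
      also have "\<dots> = cmod (turn t * 1 - of_real (s n) * b * (turn t * cnj (turn t)))"
        by (subst norm_mult[symmetric]) (simp add: algebra_simps)
      also have "turn t * cnj (turn t) = 1"
        by (metis complex_norm_square norm_turn of_real_1 one_power2)
      finally show ?thesis by simp
    qed
    ultimately have h: "has_bochner_integral circ (\<lambda>t. ln (cmod (turn t - of_real (s n) * b))) 0"
      by simp
    have "has_bochner_integral circ (\<lambda>t. ln 2 :: real) (ln 2)"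
      by (simp add: has_bochner_integral_iff)
    from has_bochner_integral_diff[OF this h] show ?thesis
      unfolding X_def using pos by (simp add: ln_div)
  qed
  have Xnn: "X n t \<ge> 0" for n t
    using pos[where n=n and t=t] le2[where n=n and t=t] by (simp add: X_def)
  have Ynn: "Y t \<ge> 0" for t
  proof (cases "turn t = b")
    case False
    have "cmod (turn t - b) \<le> 2" using norm_triangle_ineq4[of "turn t" b] b by simp
    with False show ?thesis by (simp add: Y_def)
  qed (simp add: Y_def)
  have meas [measurable]: "X n \<in> borel_measurable circ" "Y \<in> borel_measurable circ" for n
    unfolding X_def Y_def by measurable
  have AEb: "AE t in circ. turn t \<noteq> b"
    using AE_circ_turn_neq[of 1 b] by simp
  have lim: "AE t in circ. (\<lambda>n. X n t) \<longlonglongrightarrow> Y t"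
    using AEb
  proof eventually_elim
    case (elim t)
    have "(\<lambda>n. X n t) \<longlonglongrightarrow> ln (2 / cmod (turn t - of_real 1 * b))"
      unfolding X_def using elim by (intro tendsto_intros slim) auto
    then show ?case by (simp add: Y_def)
  qed
  have "(\<integral>\<^sup>+t. ennreal (Y t) \<partial>circ) \<le> (\<integral>\<^sup>+t. liminf (\<lambda>n. ennreal (X n t)) \<partial>circ)"
  proof (rule nn_integral_mono_AE)
    show "AE t in circ. ennreal (Y t) \<le> liminf (\<lambda>n. ennreal (X n t))"
      using lim by eventually_elim (simp add: lim_imp_Liminf[OF _ tendsto_ennrealI])
  qed
  also have "\<dots> \<le> liminf (\<lambda>n. \<integral>\<^sup>+t. ennreal (X n t) \<partial>circ)"
    by (rule nn_integral_liminf) measurable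
  also have "(\<lambda>n. \<integral>\<^sup>+t. ennreal (X n t) \<partial>circ) = (\<lambda>n. ennreal (ln 2))"
    using hX Xnn by (intro ext, subst nn_integral_eq_integral) (auto simp: has_bochner_integral_iff)
  finally have "(\<integral>\<^sup>+t. ennreal (Y t) \<partial>circ) < \<infinity>"
    by (simp add: Liminf_const order_le_less_trans)
  \<comment> \<open>Fatou yields integrability of \<open>Y\<close> but not the value of its
    integral; the value follows from dominated convergence, for which \<open>Y + ln 2\<close> can
    now serve as the dominating function.\<close>
  then have intY: "integrable circ Y"
    using Ynn by (intro integrableI_bounded) auto
  have "(\<lambda>n. integral\<^sup>L circ (X n)) \<longlonglongrightarrow> integral\<^sup>L circ Y"
  proof (rule integral_dominated_convergence[where w = "\<lambda>t. Y t + ln 2"])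
    show "AE t in circ. norm (X n t) \<le> Y t + ln 2" for n
      using AEb
    proof eventually_elim
      case (elim t)
      \<comment> \<open>Moving from b to s b costs 1 - s, which is at most the distance from s b to
        any point of the circle. Hence the distance to b is at most twice the distance to s
        b.\<close>
      have "cmod (turn t - b) \<le> cmod (turn t - of_real (s n) * b) + cmod (of_real (s n) * b - b)"
        using norm_triangle_ineq[of "turn t - of_real (s n) * b" "of_real (s n) * b - b"] by simp
      moreover have "cmod (of_real (s n) * b - b) = 1 - s n"
      proof -
        have "of_real (s n) * b - b = of_real (s n - 1) * b" by (simp add: algebra_simps)
        then show ?thesis using s01[of n] b by (simp only: norm_mult norm_of_real) simp
      qed
      moreover have "1 - s n \<le> cmod (turn t - of_real (s n) * b)"
        using norm_triangle_ineq2[of "turn t" "of_real (s n) * b"] s01[of n] b by (simp add: norm_mult)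
      ultimately have le: "cmod (turn t - b) \<le> 2 * cmod (turn t - of_real (s n) * b)" by simp
      have "X n t \<le> ln (2 * (2 / cmod (turn t - b)))"
        unfolding X_def using le pos[of t n] elim by (subst ln_le_cancel_iff) (auto simp: field_simps)
      also have "\<dots> = ln 2 + Y t"
        unfolding Y_def using elim by (subst ln_mult_pos) auto
      finally show ?case using Xnn[of n t] by simp
    qed
  qed (use intY lim in auto)
  moreover have "(\<lambda>n. integral\<^sup>L circ (X n)) = (\<lambda>n. ln 2)"
    using hX by (auto simp: has_bochner_integral_iff)
  ultimately have "integral\<^sup>L circ Y = ln 2"
    by (simp add: LIMSEQ_const_iff)
  with intY have hY: "has_bochner_integral circ Y (ln 2)"
    by (simp add: has_bochner_integral_iff)
  have "has_bochner_integral circ (\<lambda>t. ln 2 :: real) (ln 2)"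
    by (simp add: has_bochner_integral_iff)
  from has_bochner_integral_diff[OF this hY]
  have h0: "has_bochner_integral circ (\<lambda>t. ln 2 - Y t) 0" by simp
  have "AE t in circ. ln 2 - Y t = ln (cmod (turn t - b))"
    using AEb by eventually_elim (simp add: Y_def ln_div)
  then show ?thesis
    using h0 by (subst has_bochner_integral_cong_AE[where g = "\<lambda>t. ln 2 - Y t"]) auto
qed

text \<open>Jensen's formula for one linear factor, with the zero inside, outside or on the
  circle.\<close>

lemma circ_mean_ln_linear:
  assumes r: "r > 0"
  shows "has_bochner_integral circ (\<lambda>t. ln (cmod (of_real r * turn t - a))) (ln (max r (cmod a)))"
proof -
  consider "cmod a < r" | "cmod a > r" | "cmod a = r" by linarith
  then show ?thesis
  proof cases
    case 1
    \<comment> \<open>Reflection in the circle moves the zero out of the disc without changing the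
      modulus on the circle.\<close>
    have 2: "cmod (of_real r * turn t - a) = cmod (of_real r - cnj a * turn t)" for t
    proof -
      have "cmod (of_real r - cnj a * turn t) = cmod (cnj (of_real r - cnj a * turn t))"
        by (simp only: complex_mod_cnj)
      also have "\<dots> = cmod (turn t) * cmod (of_real r - a * cnj (turn t))"
        by simp
      also have "\<dots> = cmod (of_real r * turn t - a * (turn t * cnj (turn t)))"
        by (subst norm_mult[symmetric]) (simp add: algebra_simps)
      also have "turn t * cnj (turn t) = 1"
        by (metis complex_norm_square norm_turn of_real_1 one_power2)
      finally show ?thesis by simp
    qed
    show ?thesis
    proof (cases "a = 0")
      case True
      then show ?thesis using r by (simp add: has_bochner_integral_iff norm_mult)
    next
      case False
      have "has_bochner_integral circ (\<lambda>t. ln (cmod ((\<lambda>z. of_real r - cnj a * z) (of_real 1 * turn t))))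
          (ln (cmod ((\<lambda>z. of_real r - cnj a * z) 0)))"
      proof (rule circ_mean_ln_nonvanishing[where R = "r / cmod a"])
        fix z :: complex assume z: "z \<in> ball 0 (r / cmod a)"
        have "cmod (cnj a * z) < r"
          using z False by (simp add: norm_mult field_simps)
        then show "of_real r - cnj a * z \<noteq> 0" using r
          by (metis abs_of_pos eq_iff_diff_eq_0 less_irrefl norm_of_real)
      qed (use 1 False r in \<open>auto intro!: holomorphic_intros simp: field_simps\<close>)
      then show ?thesis using 1 r by (simp add: 2)
    qed
  next
    case 2
    have "has_bochner_integral circ (\<lambda>t. ln (cmod ((\<lambda>z. z - a) (of_real r * turn t))))
        (ln (cmod ((\<lambda>z. z - a) 0)))"
      by (rule circ_mean_ln_nonvanishing[where R = "cmod a"]) (use 2 r in \<open>auto intro!: holomorphic_intros\<close>)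
    then show ?thesis using 2 by simp
  next
    case 3
    define b where "b = a / of_real r"
    have b: "cmod b = 1" "a = of_real r * b" using 3 r by (auto simp: b_def norm_divide)
    have "has_bochner_integral circ (\<lambda>t. ln r :: real) (ln r)"
      by (simp add: has_bochner_integral_iff)
    from has_bochner_integral_add[OF this circ_mean_ln_unit[OF b(1)]]
    have h: "has_bochner_integral circ (\<lambda>t. ln r + ln (cmod (turn t - b))) (ln r)" by simp
    have "AE t in circ. ln (cmod (of_real r * turn t - a)) = ln r + ln (cmod (turn t - b))"
      using AE_circ_turn_neq[of 1 b, simplified]
    proof eventually_elim
      case (elim t)
      have "cmod (of_real r * turn t - a) = r * cmod (turn t - b)"
        unfolding b(2) using r by (simp flip: right_diff_distrib add: norm_mult)
      then show ?case using elim r by (simp add: ln_mult_pos)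
    qed
    then show ?thesis using h 3
      by (subst has_bochner_integral_cong_AE[where g = "\<lambda>t. ln r + ln (cmod (turn t - b))"]) auto
  qed
qed

section \<open>Functions with decreasing logarithmic means\<close>

definition ln_mean_decreasing :: "(complex \<Rightarrow> complex) \<Rightarrow> bool" where
  "ln_mean_decreasing h \<longleftrightarrow>
     continuous_on (ball 0 1 - {0}) h \<and>
     (\<forall>r\<in>{0<..<1}. AE t in circ. h (of_real r * turn t) \<noteq> 0) \<and>
     (\<exists>m. antimono_on {0<..<1} m \<and>
        (\<forall>r\<in>{0<..<1}. has_bochner_integral circ (\<lambda>t. ln (cmod (h (of_real r * turn t)))) (m r)))"

lemma continuous_on_circle_compose:
  assumes "continuous_on (ball 0 1 - {0}) h" "r \<in> {0<..<1}"
  shows "continuous_on A (\<lambda>t. h (of_real r * turn t))"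
  by (rule continuous_on_compose2[OF assms(1)])
     (use assms(2) in \<open>auto intro!: continuous_intros simp: norm_mult\<close>)

lemma measurable_circle_compose:
  assumes "continuous_on (ball 0 1 - {0}) h" "r \<in> {0<..<1}"
  shows "(\<lambda>t. h (of_real r * turn t)) \<in> borel_measurable borel"
  by (intro borel_measurable_continuous_onI continuous_on_circle_compose assms)

lemma ln_mean_decreasing_const: "c \<noteq> 0 \<Longrightarrow> ln_mean_decreasing (\<lambda>z. c)"
  unfolding ln_mean_decreasing_def
  by (auto intro!: exI[of _ "\<lambda>_. ln (cmod c)"] simp: has_bochner_integral_iff monotone_on_def)

text \<open>Logarithmic means add up, but ln of the modulus of a product splits only where neither
  factor vanishes, because \<open>ln 0 = 0\<close>. The almost-everywhere clause of the predicate is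
  there for this.\<close>

lemma ln_mean_decreasing_mult:
  assumes "ln_mean_decreasing g" "ln_mean_decreasing h"
  shows "ln_mean_decreasing (\<lambda>z. g z * h z)"
proof -
  obtain m1 where m1: "antimono_on {0<..<1} m1"
    "\<And>r. r \<in> {0<..<1} \<Longrightarrow> has_bochner_integral circ (\<lambda>t. ln (cmod (g (of_real r * turn t)))) (m1 r)"
    using assms(1) unfolding ln_mean_decreasing_def by blast
  obtain m2 where m2: "antimono_on {0<..<1} m2"
    "\<And>r. r \<in> {0<..<1} \<Longrightarrow> has_bochner_integral circ (\<lambda>t. ln (cmod (h (of_real r * turn t)))) (m2 r)"
    using assms(2) unfolding ln_mean_decreasing_def by blast
  have cont: "continuous_on (ball 0 1 - {0}) (\<lambda>z. g z * h z)"
    using assms unfolding ln_mean_decreasing_def by (auto intro!: continuous_on_mult)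
  have AE: "AE t in circ. g (of_real r * turn t) \<noteq> 0" "AE t in circ. h (of_real r * turn t) \<noteq> 0"
    if "r \<in> {0<..<1}" for r
    using assms that unfolding ln_mean_decreasing_def by blast+
  have "has_bochner_integral circ (\<lambda>t. ln (cmod (g (of_real r * turn t) * h (of_real r * turn t)))) (m1 r + m2 r)"
    if r: "r \<in> {0<..<1}" for r
  proof -
    note [measurable] = measurable_circle_compose[OF cont r]
    have "AE t in circ. ln (cmod (g (of_real r * turn t) * h (of_real r * turn t))) =
        ln (cmod (g (of_real r * turn t))) + ln (cmod (h (of_real r * turn t)))"
      using AE[OF r] by eventually_elim (simp add: norm_mult ln_mult_pos)
    moreover have s: "has_bochner_integral circ (\<lambda>t. ln (cmod (g (of_real r * turn t))) +
        ln (cmod (h (of_real r * turn t)))) (m1 r + m2 r)"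
      by (intro has_bochner_integral_add m1 m2 r)
    ultimately show ?thesis
      by (subst has_bochner_integral_cong_AE[OF _ _ \<open>AE t in circ. _ t = _ t\<close>])
         (auto simp: has_bochner_integral_iff)
  qed
  moreover have "antimono_on {0<..<1} (\<lambda>r. m1 r + m2 r)"
    using m1(1) m2(1) by (auto simp: monotone_on_def intro!: add_mono)
  moreover have "AE t in circ. g (of_real r * turn t) * h (of_real r * turn t) \<noteq> 0"
    if r: "r \<in> {0<..<1}" for r
    using AE[OF r] by eventually_elim simp
  ultimately show ?thesis
    unfolding ln_mean_decreasing_def using cont by blast
qed

text \<open>Over the complex numbers a polynomial splits into linear factors, so the shifts by
  constants determine everything.\<close>

lemma ln_mean_decreasing_poly:
  fixes p :: "complex poly"
  assumes lin: "\<And>y. ln_mean_decreasing (\<lambda>z. u z - y)" and "p \<noteq> 0"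
  shows "ln_mean_decreasing (\<lambda>z. poly p (u z))"
  using \<open>p \<noteq> 0\<close>
proof (induction "degree p" arbitrary: p)
  case 0
  then obtain c where "p = [:c:]" "c \<noteq> 0"
    by (metis degree_eq_zeroE pCons_0_0)
  then show ?case by (simp add: ln_mean_decreasing_const)
next
  case (Suc n)
  then have "\<exists>i\<in>{1..degree p}. coeff p i \<noteq> 0"
    by (intro bexI[of _ "degree p"]) auto
  then obtain y where "poly p y = 0"
    using fundamental_theorem_of_algebra[of "coeff p" "degree p"] unfolding poly_altdef by metis
  then obtain q where q: "p = [:- y, 1:] * q"
    by (metis dvdE poly_eq_0_iff_dvd)
  with Suc.prems have "q \<noteq> 0" by auto
  moreover from this have "degree q = n"
    using Suc.hyps(2) unfolding q by (subst (asm) degree_mult_eq) auto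
  ultimately have "ln_mean_decreasing (\<lambda>z. poly q (u z))" using Suc.hyps(1) by blast
  from ln_mean_decreasing_mult[OF lin[of y] this] show ?case
    by (simp add: q algebra_simps)
qed

section \<open>Logarithmic means of \<open>1 / f - y\<close> for univalent f\<close>

lemma difference_quotient_holomorphic:
  assumes "f holomorphic_on ball 0 1" "a \<in> ball 0 1"
  shows "(\<lambda>z. if z = a then deriv f a else (f z - f a) / (z - a)) holomorphic_on ball 0 1"
  by (rule pole_lemma[OF assms(1)]) (use assms(2) in auto)

lemma class_S_D:
  assumes "f \<in> class_S"
  shows "f holomorphic_on ball 0 1" "inj_on f (ball 0 1)" "f 0 = 0" "deriv f 0 = 1"
  using assms by (auto simp: class_S_def univalent_on_def)

lemma class_S_eq_0_iff: "f \<in> class_S \<Longrightarrow> z \<in> ball 0 1 \<Longrightarrow> f z = 0 \<longleftrightarrow> z = 0"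
  using class_S_D(2,3)[of f] unfolding inj_on_def
  by (metis centre_in_ball zero_less_one)

lemma class_S_factor:
  assumes f: "f \<in> class_S"
  obtains q where "q holomorphic_on ball 0 1" "q 0 = 1"
    "\<And>z. z \<in> ball 0 1 \<Longrightarrow> f z = z * q z" "\<And>z. z \<in> ball 0 1 \<Longrightarrow> q z \<noteq> 0"
proof -
  define q where "q z = (if z = 0 then deriv f 0 else (f z - f 0) / (z - 0))" for z
  have "q holomorphic_on ball 0 1"
    using difference_quotient_holomorphic[of f 0] class_S_D[OF f] unfolding q_def by simp
  moreover have "f z = z * q z" "q z \<noteq> 0" if "z \<in> ball 0 1" for z
    using class_S_D[OF f] class_S_eq_0_iff[OF f that] by (auto simp: q_def)
  ultimately show ?thesis
    using that[of q] class_S_D(4)[OF f] by (simp add: q_def)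
qed

lemma circ_mean_ln_class_S:
  assumes f: "f \<in> class_S" and r: "r \<in> {0<..<1}"
  shows "has_bochner_integral circ (\<lambda>t. ln (cmod (f (of_real r * turn t)))) (ln r)"
proof -
  obtain q where q: "q holomorphic_on ball 0 1" "q 0 = 1"
    "\<And>z. z \<in> ball 0 1 \<Longrightarrow> f z = z * q z" "\<And>z. z \<in> ball 0 1 \<Longrightarrow> q z \<noteq> 0"
    using class_S_factor[OF f] by metis
  have in_ball: "of_real r * turn t \<in> ball 0 1" for t
    using r by (simp add: norm_mult)
  have "has_bochner_integral circ (\<lambda>t. ln r :: real) (ln r)"
    by (simp add: has_bochner_integral_iff)
  moreover have "has_bochner_integral circ (\<lambda>t. ln (cmod (q (of_real r * turn t)))) (ln (cmod (q 0)))"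
    by (rule circ_mean_ln_nonvanishing[OF q(1,4)]) (use r in auto)
  ultimately have "has_bochner_integral circ (\<lambda>t. ln r + ln (cmod (q (of_real r * turn t)))) (ln r + ln (cmod (q 0)))"
    by (rule has_bochner_integral_add)
  moreover have "ln r + ln (cmod (q (of_real r * turn t))) = ln (cmod (f (of_real r * turn t)))" for t
    using r q(4)[OF in_ball[of t]] by (simp add: q(3)[OF in_ball] norm_mult ln_mult_pos)
  ultimately show ?thesis using q(2) by simp
qed

text \<open>This is where univalence is used. The mean stays 0 until r passes the modulus of the
  only zero and then grows exactly like \<open>ln r\<close>. It thus never grows faster than the
  mean of ln of the modulus of f, which is \<open>ln r\<close>.\<close>

lemma circ_mean_ln_one_minus_class_S:
  assumes f: "f \<in> class_S"
  obtains m where "antimono_on {0<..<1} (\<lambda>r. m r - ln r)"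
    "\<And>r. r \<in> {0<..<1} \<Longrightarrow> has_bochner_integral circ (\<lambda>t. ln (cmod (1 - y * f (of_real r * turn t)))) (m r)"
    "\<And>r. r \<in> {0<..<1} \<Longrightarrow> AE t in circ. 1 - y * f (of_real r * turn t) \<noteq> 0"
proof (cases "\<exists>a\<in>ball 0 1. y * f a = 1")
  case False
  have nz: "1 - y * f z \<noteq> 0" if "z \<in> ball 0 1" for z using False that by auto
  have hol: "(\<lambda>z. 1 - y * f z) holomorphic_on ball 0 1"
    by (intro holomorphic_intros class_S_D(1)[OF f])
  have "has_bochner_integral circ (\<lambda>t. ln (cmod (1 - y * f (of_real r * turn t)))) 0" if "r \<in> {0<..<1}" for r
    using circ_mean_ln_nonvanishing[OF hol nz, of r] that class_S_D(3)[OF f] by simp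
  moreover have "AE t in circ. 1 - y * f (of_real r * turn t) \<noteq> 0" if "r \<in> {0<..<1}" for r
    using nz that by (intro AE_I2) (auto simp: norm_mult)
  ultimately show ?thesis
    by (intro that[of "\<lambda>_. 0"]) (auto simp: monotone_on_def)
next
  case True
  then obtain a where a: "a \<in> ball 0 1" "y * f a = 1" by blast
  then have a0: "a \<noteq> 0" using class_S_D(3)[OF f] by auto
  have y0: "y \<noteq> 0" using a by auto
  define h where "h z = 1 - y * f z" for z
  have holh: "h holomorphic_on ball 0 1"
    unfolding h_def using class_S_D[OF f] by (auto intro!: holomorphic_intros)
  have ha: "h a = 0" using a by (simp add: h_def)
  define q where "q z = (if z = a then deriv h a else (h z - h a) / (z - a))" for z
  have holq: "q holomorphic_on ball 0 1"
    unfolding q_def by (rule difference_quotient_holomorphic[OF holh a(1)])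
  have injh: "inj_on h (ball 0 1)"
    using class_S_D(2)[OF f] y0 by (auto simp: inj_on_def h_def)
  \<comment> \<open>An injective holomorphic function has no critical point, so the zero is simple
    and dividing out z - a leaves a function without zeros.\<close>
  have "deriv h a \<noteq> 0"
    by (rule holomorphic_injective_imp_regular[OF holh _ injh a(1)]) simp
  moreover have "h z \<noteq> 0" if "z \<in> ball 0 1" "z \<noteq> a" for z
    using injh that a(1) ha unfolding inj_on_def by metis
  ultimately have nz: "q z \<noteq> 0" if "z \<in> ball 0 1" for z
    using that by (auto simp: q_def ha)
  have hq: "h z = (z - a) * q z" for z
    by (auto simp: q_def ha)
  have q0: "cmod (q 0) = 1 / cmod a"
    unfolding q_def ha using a0 class_S_D(3)[OF f] by (simp add: h_def norm_divide)
  define m where "m r = ln (max r (cmod a)) - ln (cmod a)" for r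
  have AE: "AE t in circ. h (of_real r * turn t) \<noteq> 0" if r: "r \<in> {0<..<1}" for r
  proof -
    have "AE t in circ. of_real r * turn t \<noteq> a" by (rule AE_circ_turn_neq) (use r in auto)
    then show ?thesis
    proof eventually_elim
      case (elim t)
      moreover have "of_real r * turn t \<in> ball 0 1" using r by (simp add: norm_mult)
      ultimately show ?case using nz by (simp add: hq)
    qed
  qed
  have "has_bochner_integral circ (\<lambda>t. ln (cmod (h (of_real r * turn t)))) (m r)" if r: "r \<in> {0<..<1}" for r
  proof -
    have "has_bochner_integral circ (\<lambda>t. ln (cmod (of_real r * turn t - a)) + ln (cmod (q (of_real r * turn t))))
        (ln (max r (cmod a)) + ln (cmod (q 0)))"
      by (intro has_bochner_integral_add circ_mean_ln_linear circ_mean_ln_nonvanishing[OF holq nz])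
         (use r in auto)
    moreover have "AE t in circ. ln (cmod (h (of_real r * turn t))) =
        ln (cmod (of_real r * turn t - a)) + ln (cmod (q (of_real r * turn t)))"
      using AE[OF r] by eventually_elim (simp add: hq norm_mult ln_mult_pos)
    moreover have "(\<lambda>t. ln (cmod (h (of_real r * turn t)))) \<in> borel_measurable circ"
    proof -
      have "continuous_on (ball 0 1 - {0}) h"
        by (intro holomorphic_on_imp_continuous_on holomorphic_on_subset[OF holh]) auto
      note [measurable] = measurable_circle_compose[OF this r]
      show ?thesis by measurable
    qed
    ultimately have "has_bochner_integral circ (\<lambda>t. ln (cmod (h (of_real r * turn t))))
        (ln (max r (cmod a)) + ln (cmod (q 0)))"
      by (subst has_bochner_integral_cong_AE) (auto simp: has_bochner_integral_iff)
    then show ?thesis using a0 by (simp add: m_def q0 ln_div)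
  qed
  moreover have "antimono_on {0<..<1} (\<lambda>r. m r - ln r)"
  proof (rule monotone_onI)
    fix r s :: real assume rs: "r \<in> {0<..<1}" "s \<in> {0<..<1}" "r \<le> s"
    \<comment> \<open>The quotient max(r, |a|) / r is 1 or |a| / r, whichever is larger, hence
      decreasing in r.\<close>
    have "max s (cmod a) * r \<le> max r (cmod a) * s"
      using rs a0 by (auto simp: max_def mult_ac intro: mult_right_mono mult_mono)
    then have "max s (cmod a) / s \<le> max r (cmod a) / r"
      using rs by (simp add: field_simps)
    then have "ln (max s (cmod a) / s) \<le> ln (max r (cmod a) / r)"
      using rs by (subst ln_le_cancel_iff) (auto simp: less_max_iff_disj)
    then show "m s - ln s \<le> m r - ln r"
      using rs by (simp add: m_def ln_divide_pos less_max_iff_disj)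
  qed
  ultimately show ?thesis
    using that[of m] AE unfolding h_def by simp
qed

text \<open>Since 1/f - y = (1 - y f)/f, its logarithmic mean is \<open>m r - ln r\<close>.\<close>

lemma ln_mean_decreasing_inverse_class_S:
  assumes f: "f \<in> class_S"
  shows "ln_mean_decreasing (\<lambda>z. 1 / f z - y)"
proof -
  obtain m where m: "antimono_on {0<..<1} (\<lambda>r. m r - ln r)"
    "\<And>r. r \<in> {0<..<1} \<Longrightarrow> has_bochner_integral circ (\<lambda>t. ln (cmod (1 - y * f (of_real r * turn t)))) (m r)"
    "\<And>r. r \<in> {0<..<1} \<Longrightarrow> AE t in circ. 1 - y * f (of_real r * turn t) \<noteq> 0"
    by (rule circ_mean_ln_one_minus_class_S[OF f, of y]) (rule that)
  have fnz: "f z \<noteq> 0" if "z \<in> ball 0 1 - {0}" for z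
    using class_S_eq_0_iff[OF f] that by auto
  have cont: "continuous_on (ball 0 1 - {0}) (\<lambda>z. 1 / f z - y)"
    by (intro continuous_intros continuous_on_subset[OF holomorphic_on_imp_continuous_on[OF class_S_D(1)[OF f]]])
       (use fnz in auto)
  have fnz': "f (of_real r * turn t) \<noteq> 0" if "r \<in> {0<..<1}" for r t
    using that by (intro fnz) (auto simp: norm_mult)
  have eq: "1 / f (of_real r * turn t) - y = (1 - y * f (of_real r * turn t)) / f (of_real r * turn t)"
    if "r \<in> {0<..<1}" for r t
    using fnz'[OF that, of t] by (simp add: field_simps)
  have AE: "AE t in circ. 1 / f (of_real r * turn t) - y \<noteq> 0" if "r \<in> {0<..<1}" for r
    using m(3)[OF that] by eventually_elim (use fnz'[OF that] eq[OF that] in auto)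
  have "has_bochner_integral circ (\<lambda>t. ln (cmod (1 / f (of_real r * turn t) - y))) (m r - ln r)"
    if r: "r \<in> {0<..<1}" for r
  proof -
    note [measurable] = measurable_circle_compose[OF cont r]
    have "has_bochner_integral circ (\<lambda>t. ln (cmod (1 - y * f (of_real r * turn t))) -
        ln (cmod (f (of_real r * turn t)))) (m r - ln r)"
      by (intro has_bochner_integral_diff m(2) circ_mean_ln_class_S f r)
    moreover have "AE t in circ. ln (cmod (1 / f (of_real r * turn t) - y)) =
        ln (cmod (1 - y * f (of_real r * turn t))) - ln (cmod (f (of_real r * turn t)))"
      using m(3)[OF r] by eventually_elim (use fnz'[OF r] in \<open>simp add: eq[OF r] norm_divide ln_div\<close>)
    ultimately show ?thesis
      by (subst has_bochner_integral_cong_AE) (auto simp: has_bochner_integral_iff)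
  qed
  then show ?thesis
    unfolding ln_mean_decreasing_def using cont AE m(1) by blast
qed

lemma ln_mean_decreasing_poly_inverse_class_S:
  assumes "f \<in> class_S" "p \<noteq> 0"
  shows "ln_mean_decreasing (\<lambda>z. poly p (1 / f z))"
  by (rule ln_mean_decreasing_poly[OF ln_mean_decreasing_inverse_class_S]) fact+

section \<open>The area inequality\<close>

lemma integral_ln_max:
  assumes a: "0 < a" "a \<le> 1"
  shows "has_bochner_integral circ (\<lambda>s. ln (max a s)) (a - 1)"
proof -
  have "((\<lambda>s. ln (max a s)) has_integral (ln a * a)) {0..a}"
  proof (rule has_integral_eq)
    show "((\<lambda>s. ln a) has_integral (ln a * a)) {0..a}"
      using has_integral_const_real[of "ln a" 0 a] a by (simp add: mult.commute)
  qed auto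
  moreover have "((\<lambda>s. ln (max a s)) has_integral ((1 * ln 1 - 1) - (a * ln a - a))) {a..1}"
  proof (rule has_integral_eq)
    show "(ln has_integral ((1 * ln 1 - 1) - (a * ln a - a))) {a..1}"
    proof (rule fundamental_theorem_of_calculus)
      fix x assume "x \<in> {a..1}"
      then show "((\<lambda>s. s * ln s - s) has_vector_derivative ln x) (at x within {a..1})"
        using a by (auto intro!: derivative_eq_intros simp flip: has_real_derivative_iff_has_vector_derivative)
    qed (use a in auto)
  qed (use a in auto)
  ultimately have "((\<lambda>s. ln (max a s)) has_integral (ln a * a + ((1 * ln 1 - 1) - (a * ln a - a)))) {0..1}"
    by (intro has_integral_combine[of 0 a 1]) (use a in auto)
  moreover have "integrable circ (\<lambda>s. ln (max a s))"
    by (intro integrable_circ_continuous continuous_intros) (use a in \<open>auto simp: max_def\<close>)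
  ultimately show ?thesis
    by (simp add: has_bochner_integral_iff integral_circ_eq integral_unique algebra_simps)
qed

lemma measurable_circ_borel: "f \<in> measurable M circ \<Longrightarrow> f \<in> borel_measurable M"
  using measurable_compose[of f M circ "\<lambda>x. x" borel] by (simp add: measurable_circI)

interpretation circ2: pair_sigma_finite circ circ ..

lemma circ_Fubini:
  assumes "case_prod h \<in> borel_measurable borel"
  shows "(\<integral>\<^sup>+s. (\<integral>\<^sup>+t. ennreal (h s t) \<partial>circ) \<partial>circ) = (\<integral>\<^sup>+t. (\<integral>\<^sup>+s. ennreal (h s t) \<partial>circ) \<partial>circ)"
proof -
  have "(\<lambda>x. x) \<in> measurable (circ \<Otimes>\<^sub>M circ) (borel \<Otimes>\<^sub>M borel)"
  proof -
    have "(\<lambda>x. (fst x, snd x)) \<in> measurable (circ \<Otimes>\<^sub>M circ) (borel \<Otimes>\<^sub>M borel :: (real \<times> real) measure)"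
      by (intro measurable_Pair measurable_compose[OF measurable_fst] measurable_compose[OF measurable_snd] measurable_circI)
         auto
    then show ?thesis by simp
  qed
  then have "(\<lambda>x. x) \<in> measurable (circ \<Otimes>\<^sub>M circ) (borel :: (real \<times> real) measure)"
    by (simp add: borel_prod)
  from measurable_compose[OF this assms]
  have [measurable]: "case_prod h \<in> borel_measurable (circ \<Otimes>\<^sub>M circ)" by simp
  have "case_prod (\<lambda>t s. ennreal (h s t)) \<in> borel_measurable (circ \<Otimes>\<^sub>M circ)"
  proof -
    have "(\<lambda>x. ennreal (case_prod h (snd x, fst x))) \<in> borel_measurable (circ \<Otimes>\<^sub>M circ)"
      by measurable
    then show ?thesis by (simp add: case_prod_beta')
  qed
  from circ2.Fubini'[OF this] show ?thesis by simp
qed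

text \<open>The average of the logarithmic potential over the circle of radius \<open>\<rho>\<close>, integrated over
  \<open>\<rho>\<close>, recovers the modulus: this turns monotonicity of all logarithmic means of \<open>E - v\<close> into
  monotonicity of the mean of \<open>\<bar>E\<bar>\<close>.\<close>

lemma circ_mean_ln_kernel:
  assumes w: "0 < cmod w" "cmod w \<le> B"
  shows "(\<integral>\<^sup>+s. (\<integral>\<^sup>+u. ennreal (ln (2 * B / cmod (w - of_real (B * s) * turn u))) \<partial>circ) \<partial>circ)
    = ennreal (1 + ln 2 - cmod w / B)"
proof -
  have B: "B > 0" using w by linarith
  have inner: "(\<integral>\<^sup>+u. ennreal (ln (2 * B / cmod (w - of_real (B * s) * turn u))) \<partial>circ)
      = ennreal (ln 2 - ln (max (cmod w / B) s))" if s: "0 < s" "s \<le> 1" for s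
  proof -
    have "has_bochner_integral circ (\<lambda>u. ln (2 * B) :: real) (ln (2 * B))"
      by (simp add: has_bochner_integral_iff)
    from has_bochner_integral_diff[OF this circ_mean_ln_linear[of "B * s" w]]
    have h: "has_bochner_integral circ (\<lambda>u. ln (2 * B) - ln (cmod (of_real (B * s) * turn u - w)))
        (ln (2 * B) - ln (max (B * s) (cmod w)))" using B s by simp
    have "AE u in circ. of_real (B * s) * turn u \<noteq> w"
      by (rule AE_circ_turn_neq) (use B s in simp)
    then have ae: "AE u in circ. ln (2 * B / cmod (w - of_real (B * s) * turn u)) =
        ln (2 * B) - ln (cmod (of_real (B * s) * turn u - w))"
      by eventually_elim (use B in \<open>simp add: ln_divide_pos norm_minus_commute\<close>)
    have nn: "ln (2 * B / cmod (w - of_real (B * s) * turn u)) \<ge> 0" for u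
    proof (cases "w = of_real (B * s) * turn u")
      case False
      have "B * s \<le> B" using mult_left_mono[of s 1 B] B s by simp
      have "cmod (w - of_real (B * s) * turn u) \<le> cmod w + cmod (of_real (B * s) * turn u)"
        by (rule norm_triangle_ineq4)
      also have "cmod (of_real (B * s) * turn u) = B * s"
        using B s by (simp add: norm_mult abs_mult)
      also have "cmod w + B * s \<le> 2 * B"
        using w(2) \<open>B * s \<le> B\<close> by linarith
      finally show ?thesis using False by simp
    qed simp
    have "has_bochner_integral circ (\<lambda>u. ln (2 * B / cmod (w - of_real (B * s) * turn u)))
        (ln (2 * B) - ln (max (B * s) (cmod w)))"
      using h ae by (subst has_bochner_integral_cong_AE[OF _ _ ae]) (auto simp: has_bochner_integral_iff)
    then have "(\<integral>\<^sup>+u. ennreal (ln (2 * B / cmod (w - of_real (B * s) * turn u))) \<partial>circ)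
       = ennreal (ln (2 * B) - ln (max (B * s) (cmod w)))"
      using nn by (subst nn_integral_eq_integral) (auto simp: has_bochner_integral_iff)
    also have "max (B * s) (cmod w) = B * max (cmod w / B) s"
      using B by (simp add: max_mult_distrib_left max.commute)
    also have "ln (2 * B) - ln (B * max (cmod w / B) s) = ln 2 - ln (max (cmod w / B) s)"
      using B s by (simp add: ln_mult_pos less_max_iff_disj)
    finally show ?thesis .
  qed
  have "AE s in lborel. s \<noteq> (0::real)"
    using AE_lborel_singleton by blast
  then have "AE s in circ. s \<noteq> 0"
    unfolding circ_def by (subst AE_restrict_space_iff) auto
  then have ae: "AE s in circ. (\<integral>\<^sup>+u. ennreal (ln (2 * B / cmod (w - of_real (B * s) * turn u))) \<partial>circ)
      = ennreal (ln 2 - ln (max (cmod w / B) s))"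
    using AE_space by eventually_elim (use inner in auto)
  have "has_bochner_integral circ (\<lambda>s. ln 2 :: real) (ln 2)"
    by (simp add: has_bochner_integral_iff)
  from has_bochner_integral_diff[OF this integral_ln_max[of "cmod w / B"]]
  have h: "has_bochner_integral circ (\<lambda>s. ln 2 - ln (max (cmod w / B) s)) (1 + ln 2 - cmod w / B)"
    using w B by (simp add: algebra_simps)
  have "(\<integral>\<^sup>+s. (\<integral>\<^sup>+u. ennreal (ln (2 * B / cmod (w - of_real (B * s) * turn u))) \<partial>circ) \<partial>circ)
      = (\<integral>\<^sup>+s. ennreal (ln 2 - ln (max (cmod w / B) s)) \<partial>circ)"
    by (rule nn_integral_cong_AE[OF ae])
  also have "\<dots> = ennreal (1 + ln 2 - cmod w / B)"
  proof (subst nn_integral_eq_integral)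
    show "AE s in circ. 0 \<le> ln 2 - ln (max (cmod w / B) s)"
    proof (rule AE_I2)
      fix s assume "s \<in> space circ"
      then have "max (cmod w / B) s \<le> 2" "max (cmod w / B) s > 0"
        using w B by (auto simp: field_simps less_max_iff_disj)
      then show "0 \<le> ln 2 - ln (max (cmod w / B) s)" by simp
    qed
  qed (use h in \<open>auto simp: has_bochner_integral_iff\<close>)
  finally show ?thesis .
qed

text \<open>The modulus is, up to constants, a superposition of logarithmic potentials with positive
  density on a disc: the Laplacian of |v| is 1/|v|, which is the density obtained by choosing the
  radius and the angle of v uniformly. Averaging the hypotheses over v with this density gives the
  claim.\<close>

lemma circ_mean_norm_decreasing:
  assumes E: "\<And>v. ln_mean_decreasing (\<lambda>z. E z - v)"
    and r: "0 < r1" "r1 \<le> r2" "r2 < 1"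
  shows "(LINT t|circ. cmod (E (of_real r2 * turn t))) \<le> (LINT t|circ. cmod (E (of_real r1 * turn t)))"
proof -
  have cont: "continuous_on (ball 0 1 - {0}) E"
    using E[of 0] by (simp add: ln_mean_decreasing_def)
  have rr: "r1 \<in> {0<..<1}" "r2 \<in> {0<..<1}" using r by auto
  define e where "e r t = E (of_real r * turn t)" for r t
  have conte: "continuous_on A (e r)" if "r \<in> {0<..<1}" for r A
    unfolding e_def by (rule continuous_on_circle_compose[OF cont that])
  have "bounded (e r1 ` {0..1} \<union> e r2 ` {0..1})"
    by (intro compact_imp_bounded compact_Un compact_continuous_image conte rr) auto
  then obtain B0 where B0: "\<And>t. t \<in> {0..1} \<Longrightarrow> cmod (e r1 t) \<le> B0" "\<And>t. t \<in> {0..1} \<Longrightarrow> cmod (e r2 t) \<le> B0"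
    unfolding bounded_iff by blast
  \<comment> \<open>One bound for both circles, so that both are tested against the same points v.
    It also makes \<open>ln (2 * B / ...)\<close> nonnegative, and the order of integration can be
    exchanged without integrability checks.\<close>
  define B where "B = max B0 1"
  have B: "B > 0" by (simp add: B_def)
  have eB: "cmod (e r t) \<le> B" if "t \<in> {0..1}" "r = r1 \<or> r = r2" for t r
    using B0 that by (auto simp: B_def max_def intro: order_trans)
  define k where "k r v t = ln (2 * B / cmod (e r t - v))" for r v t
  have knn: "k r v t \<ge> 0" if "t \<in> {0..1}" "r = r1 \<or> r = r2" "cmod v \<le> B" for r v t
  proof (cases "e r t = v")
    case False
    have "cmod (e r t - v) \<le> 2 * B"
      using norm_triangle_ineq4[of "e r t" v] eB[OF that(1,2)] that(3) by linarith
    then show ?thesis using False B by (simp add: k_def)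
  qed (simp add: k_def)
  have mono: "(\<integral>\<^sup>+t. ennreal (k r1 v t) \<partial>circ) \<le> (\<integral>\<^sup>+t. ennreal (k r2 v t) \<partial>circ)" if v: "cmod v \<le> B" for v
  proof -
    obtain m where m: "antimono_on {0<..<1} m"
      "\<And>r. r \<in> {0<..<1} \<Longrightarrow> has_bochner_integral circ (\<lambda>t. ln (cmod (e r t - v))) (m r)"
      using E[of v] unfolding ln_mean_decreasing_def e_def by blast
    have AE: "AE t in circ. e r t - v \<noteq> 0" if "r \<in> {0<..<1}" for r
      using E[of v] that unfolding ln_mean_decreasing_def e_def by blast
    have "(\<integral>\<^sup>+t. ennreal (k r v t) \<partial>circ) = ennreal (ln (2 * B) - m r)"
      if r12: "r = r1 \<or> r = r2" for r
    proof -
      have r01: "r \<in> {0<..<1}" using rr r12 by auto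
      have "has_bochner_integral circ (\<lambda>t. ln (2 * B) :: real) (ln (2 * B))"
        by (simp add: has_bochner_integral_iff)
      from has_bochner_integral_diff[OF this m(2)[OF r01]]
      have h: "has_bochner_integral circ (\<lambda>t. ln (2 * B) - ln (cmod (e r t - v))) (ln (2 * B) - m r)" .
      have ae: "AE t in circ. k r v t = ln (2 * B) - ln (cmod (e r t - v))"
        using AE[OF r01] by eventually_elim (use B in \<open>simp add: k_def ln_divide_pos\<close>)
      have [measurable]: "e r \<in> borel_measurable borel"
        by (intro borel_measurable_continuous_onI conte r01)
      have "k r v \<in> borel_measurable circ" unfolding k_def by measurable
      then have "has_bochner_integral circ (k r v) (ln (2 * B) - m r)"
        using h by (subst has_bochner_integral_cong_AE[OF _ _ ae]) (auto simp: has_bochner_integral_iff)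
      then show ?thesis using knn[OF _ r12 v]
        by (subst nn_integral_eq_integral) (auto simp: has_bochner_integral_iff)
    qed
    moreover have "m r2 \<le> m r1" using m(1) rr r(2) by (auto simp: monotone_on_def)
    ultimately show ?thesis by (auto intro!: ennreal_leI)
  qed
  have key: "(\<integral>\<^sup>+s. (\<integral>\<^sup>+u. (\<integral>\<^sup>+t. ennreal (k r (of_real (B * s) * turn u) t) \<partial>circ) \<partial>circ) \<partial>circ)
      = ennreal (1 + ln 2 - (LINT t|circ. cmod (e r t)) / B)" if r12: "r = r1 \<or> r = r2" for r
  proof -
    have r01: "r \<in> {0<..<1}" using rr r12 by auto
    have [measurable]: "e r \<in> borel_measurable borel"
      by (intro borel_measurable_continuous_onI conte r01)
    \<comment> \<open>The kernel formula requires a nonzero point.\<close>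
    have AE: "AE t in circ. e r t \<noteq> 0"
      using E[of 0] r01 unfolding ln_mean_decreasing_def e_def by simp
    have "(\<integral>\<^sup>+u. (\<integral>\<^sup>+t. ennreal (k r (of_real (B * s) * turn u) t) \<partial>circ) \<partial>circ) =
        (\<integral>\<^sup>+t. (\<integral>\<^sup>+u. ennreal (k r (of_real (B * s) * turn u) t) \<partial>circ) \<partial>circ)" for s
      by (rule circ_Fubini) (unfold k_def borel_prod[symmetric], measurable)
    then have "(\<integral>\<^sup>+s. (\<integral>\<^sup>+u. (\<integral>\<^sup>+t. ennreal (k r (of_real (B * s) * turn u) t) \<partial>circ) \<partial>circ) \<partial>circ)
      = (\<integral>\<^sup>+s. (\<integral>\<^sup>+t. (\<integral>\<^sup>+u. ennreal (k r (of_real (B * s) * turn u) t) \<partial>circ) \<partial>circ) \<partial>circ)" by simp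
    also have "\<dots> = (\<integral>\<^sup>+t. (\<integral>\<^sup>+s. (\<integral>\<^sup>+u. ennreal (k r (of_real (B * s) * turn u) t) \<partial>circ) \<partial>circ) \<partial>circ)"
    proof (rule circ2.Fubini')
      note measurable_circ_borel [measurable (raw)]
      have "(\<lambda>x. \<integral>\<^sup>+u. ennreal (k r (of_real (B * snd x) * turn u) (fst x)) \<partial>circ)
          \<in> borel_measurable (circ \<Otimes>\<^sub>M circ)"
        unfolding k_def by measurable
      then show "(\<lambda>(t, s). \<integral>\<^sup>+u. ennreal (k r (of_real (B * s) * turn u) t) \<partial>circ)
          \<in> borel_measurable (circ \<Otimes>\<^sub>M circ)"
        by (simp add: case_prod_beta')
    qed
    also have "\<dots> = (\<integral>\<^sup>+t. ennreal (1 + ln 2 - cmod (e r t) / B) \<partial>circ)"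
    proof (rule nn_integral_cong_AE)
      show "AE t in circ. (\<integral>\<^sup>+s. (\<integral>\<^sup>+u. ennreal (k r (of_real (B * s) * turn u) t) \<partial>circ) \<partial>circ)
          = ennreal (1 + ln 2 - cmod (e r t) / B)"
        using AE AE_space unfolding k_def
        by eventually_elim (use eB r12 in \<open>auto intro!: circ_mean_ln_kernel simp del: of_real_mult\<close>)
    qed
    also have "\<dots> = ennreal (1 + ln 2 - (LINT t|circ. cmod (e r t)) / B)"
    proof -
      have "integrable circ (\<lambda>t. cmod (e r t))"
        by (intro integrable_circ_continuous continuous_intros conte r01)
      then have "integrable circ (\<lambda>t. 1 + ln 2 - cmod (e r t) / B)"
        "(LINT t|circ. 1 + ln 2 - cmod (e r t) / B) = 1 + ln 2 - (LINT t|circ. cmod (e r t)) / B"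
        by auto
      moreover have "0 \<le> 1 + ln 2 - cmod (e r t) / B" if "t \<in> {0..1}" for t
      proof -
        have "cmod (e r t) / B \<le> 1" using eB[OF that r12] B by simp
        moreover have "0 \<le> ln (2::real)" by simp
        ultimately show ?thesis by linarith
      qed
      ultimately show ?thesis by (subst nn_integral_eq_integral) auto
    qed
    finally show ?thesis .
  qed
  have "(\<integral>\<^sup>+s. (\<integral>\<^sup>+u. (\<integral>\<^sup>+t. ennreal (k r1 (of_real (B * s) * turn u) t) \<partial>circ) \<partial>circ) \<partial>circ)
      \<le> (\<integral>\<^sup>+s. (\<integral>\<^sup>+u. (\<integral>\<^sup>+t. ennreal (k r2 (of_real (B * s) * turn u) t) \<partial>circ) \<partial>circ) \<partial>circ)"
  proof (rule nn_integral_mono, rule nn_integral_mono, rule mono)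
    fix s u assume "s \<in> space circ"
    then show "cmod (of_real (B * s) * turn u) \<le> B"
      using B by (simp add: norm_mult abs_mult)
  qed
  then have le: "ennreal (1 + ln 2 - (LINT t|circ. cmod (e r1 t)) / B)
      \<le> ennreal (1 + ln 2 - (LINT t|circ. cmod (e r2 t)) / B)"
    by (simp only: key simp_thms)
  \<comment> \<open>\<open>ennreal\<close> truncates negative numbers to 0, so the comparison passes
    to the reals only once the larger side is known to be nonnegative.\<close>
  have "(LINT t|circ. cmod (e r2 t)) \<le> (LINT t|circ. B)"
    by (intro integral_mono integrable_circ_continuous continuous_intros conte rr) (use eB in auto)
  then have "(LINT t|circ. cmod (e r2 t)) / B \<le> 1" using B by simp
  moreover have "0 \<le> ln (2::real)" by simp
  ultimately have "0 \<le> 1 + ln 2 - (LINT t|circ. cmod (e r2 t)) / B" by linarith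
  with le have "(LINT t|circ. cmod (e r2 t)) / B \<le> (LINT t|circ. cmod (e r1 t)) / B"
    by (simp add: ennreal_le_iff)
  then show ?thesis using B by (simp add: e_def divide_le_cancel)
qed

section \<open>Parseval's identity and the area inequality\<close>

lemma circ_Parseval:
  assumes K: "K holomorphic_on ball 0 1" and r: "0 < r" "r < 1"
  shows "(\<lambda>m. (cmod (fps_nth (fps_expansion K 0) m))\<^sup>2 * r ^ (2 * m)) sums
           (LINT t|circ. (cmod (K (of_real r * turn t)))\<^sup>2)"
proof -
  define c where "c = fps_nth (fps_expansion K 0)"
  define z where "z t = of_real r * turn t" for t
  define S where "S n t = (\<Sum>m<n. c m * z t ^ m)" for n t
  have cmz: "cmod (z t) = r" for t using r by (simp add: z_def norm_mult)
  have contz: "continuous_on A z" for A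
    unfolding z_def by (intro continuous_intros)
  have contS: "continuous_on A (S n)" for n A
    unfolding S_def by (intro continuous_intros contz)
  have sums: "(\<lambda>m. c m * w ^ m) sums K w" if "w \<in> ball 0 1" for w
    using holomorphic_power_series[OF K that] by (simp add: c_def fps_expansion_def)
  have summ: "summable (\<lambda>m. cmod (c m) * r ^ m)"
  proof -
    obtain r' where r': "r < r'" "r' < 1" using dense r(2) by blast
    have "summable (\<lambda>m. c m * of_real r' ^ m)"
      using sums[of "of_real r'"] r r' by (auto simp: sums_iff)
    from powser_insidea[OF this, of "of_real r"] show ?thesis
      using r r' by (simp add: norm_mult norm_power)
  qed
  have mean_pow: "integral\<^sup>L circ (\<lambda>t. z t ^ Suc p) = 0" for p
  proof -
    have "(\<lambda>w. w ^ Suc p) holomorphic_on ball 0 1" by (intro holomorphic_intros)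
    from circ_mean_value[OF this r] show ?thesis
      by (simp add: has_bochner_integral_iff z_def)
  qed
  \<comment> \<open>On the circle the conjugate of z is r^2 / z, so z^n times the conjugate of a
    lower power is a multiple of a positive power of z, whose mean is 0.\<close>
  have cross: "integral\<^sup>L circ (\<lambda>t. c n * z t ^ n * cnj (S n t)) = 0" for n
  proof -
    have eq: "c n * z t ^ n * cnj (S n t) = (\<Sum>m<n. (c n * cnj (c m) * of_real r ^ (2 * m)) * z t ^ Suc (n - m - 1))" for t
    proof -
      have "z t ^ n * cnj (z t) ^ m = of_real r ^ (2 * m) * z t ^ Suc (n - m - 1)" if "m < n" for m
      proof -
        have "z t ^ n = z t ^ m * z t ^ Suc (n - m - 1)"
          unfolding power_add[symmetric] using that by (intro arg_cong2[where f = power] refl) simp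
        then have "z t ^ n * cnj (z t) ^ m = (z t * cnj (z t)) ^ m * z t ^ Suc (n - m - 1)"
          by (simp add: power_mult_distrib)
        also have "z t * cnj (z t) = of_real r ^ 2"
          by (simp add: complex_norm_square[symmetric] cmz)
        finally show ?thesis by (simp add: power_mult)
      qed
      then show ?thesis
        unfolding S_def cnj_sum sum_distrib_left
        by (intro sum.cong) (auto simp: algebra_simps)
    qed
    have "integral\<^sup>L circ (\<lambda>t. \<Sum>m<n. (c n * cnj (c m) * of_real r ^ (2 * m)) * z t ^ Suc (n - m - 1))
        = (\<Sum>m<n. integral\<^sup>L circ (\<lambda>t. (c n * cnj (c m) * of_real r ^ (2 * m)) * z t ^ Suc (n - m - 1)))"
      by (intro Bochner_Integration.integral_sum integrable_circ_continuous continuous_intros contz)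
    also have "\<dots> = 0"
      by (simp only: integral_mult_right_zero mean_pow mult_zero_right sum.neutral_const)
    finally show ?thesis by (simp only: eq)
  qed
  have partial: "integral\<^sup>L circ (\<lambda>t. (cmod (S n t))\<^sup>2) = (\<Sum>m<n. (cmod (c m))\<^sup>2 * r ^ (2 * m))" for n
  proof (induction n)
    case 0
    then show ?case by (simp add: S_def)
  next
    case (Suc n)
    have "(cmod (S (Suc n) t))\<^sup>2 = (cmod (S n t))\<^sup>2 + 2 * Re (c n * z t ^ n * cnj (S n t)) + (cmod (c n))\<^sup>2 * r ^ (2 * n)" for t
    proof -
      have "(cmod (S (Suc n) t))\<^sup>2 = (cmod (S n t + c n * z t ^ n))\<^sup>2" by (simp add: S_def)
      also have "\<dots> = (cmod (S n t))\<^sup>2 + 2 * Re (c n * z t ^ n * cnj (S n t)) + (cmod (c n * z t ^ n))\<^sup>2"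
        unfolding cmod_power2 by (simp add: power2_eq_square algebra_simps)
      also have "(cmod (c n * z t ^ n))\<^sup>2 = (cmod (c n))\<^sup>2 * r ^ (2 * n)"
        by (simp add: norm_mult norm_power cmz power_mult_distrib power_mult[symmetric] mult.commute)
      finally show ?thesis .
    qed
    then have "integral\<^sup>L circ (\<lambda>t. (cmod (S (Suc n) t))\<^sup>2) =
        integral\<^sup>L circ (\<lambda>t. (cmod (S n t))\<^sup>2 + 2 * Re (c n * z t ^ n * cnj (S n t)) + (cmod (c n))\<^sup>2 * r ^ (2 * n))"
      by simp
    also have "\<dots> = integral\<^sup>L circ (\<lambda>t. (cmod (S n t))\<^sup>2) + 2 * integral\<^sup>L circ (\<lambda>t. Re (c n * z t ^ n * cnj (S n t)))
        + (cmod (c n))\<^sup>2 * r ^ (2 * n)"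
    proof -
      have i: "integrable circ (\<lambda>t. (cmod (S n t))\<^sup>2)" "integrable circ (\<lambda>t. Re (c n * z t ^ n * cnj (S n t)))"
        by (intro integrable_circ_continuous continuous_intros contz contS)+
      then show ?thesis by (simp del: times_complex.sel)
    qed
    also have "integral\<^sup>L circ (\<lambda>t. Re (c n * z t ^ n * cnj (S n t))) = 0"
      by (subst integral_Re)
         (auto simp: cross intro!: integrable_circ_continuous continuous_intros contz contS)
    finally show ?case by (simp add: Suc.IH)
  qed
  have "(\<lambda>n. integral\<^sup>L circ (\<lambda>t. (cmod (S n t))\<^sup>2)) \<longlonglongrightarrow> integral\<^sup>L circ (\<lambda>t. (cmod (K (z t)))\<^sup>2)"
  proof (rule integral_dominated_convergence[where w = "\<lambda>_. (\<Sum>m. cmod (c m) * r ^ m)\<^sup>2"])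
    have "continuous_on UNIV (\<lambda>t. K (z t))"
      by (rule continuous_on_compose2[OF holomorphic_on_imp_continuous_on[OF K] contz]) (use cmz r in auto)
    then show "(\<lambda>t. (cmod (K (z t)))\<^sup>2) \<in> borel_measurable circ"
      by (intro measurable_circI borel_measurable_continuous_onI continuous_intros)
    show "(\<lambda>t. (cmod (S n t))\<^sup>2) \<in> borel_measurable circ" for n
      by (intro measurable_circI borel_measurable_continuous_onI continuous_intros contS)
    show "AE t in circ. (\<lambda>n. (cmod (S n t))\<^sup>2) \<longlonglongrightarrow> (cmod (K (z t)))\<^sup>2"
    proof (rule AE_I2)
      fix t
      have "(\<lambda>n. S n t) \<longlonglongrightarrow> K (z t)"
        using sums[of "z t"] cmz[of t] r unfolding S_def sums_def by simp
      then show "(\<lambda>n. (cmod (S n t))\<^sup>2) \<longlonglongrightarrow> (cmod (K (z t)))\<^sup>2" by (intro tendsto_intros)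
    qed
    show "AE t in circ. norm ((cmod (S n t))\<^sup>2) \<le> (\<Sum>m. cmod (c m) * r ^ m)\<^sup>2" for n
    proof (rule AE_I2)
      fix t
      have "cmod (S n t) \<le> (\<Sum>m<n. cmod (c m) * r ^ m)"
        unfolding S_def by (rule order_trans[OF norm_sum]) (simp add: norm_mult norm_power cmz)
      also have "\<dots> \<le> (\<Sum>m. cmod (c m) * r ^ m)"
        by (rule sum_le_suminf[OF summ]) (use r in auto)
      finally show "norm ((cmod (S n t))\<^sup>2) \<le> (\<Sum>m. cmod (c m) * r ^ m)\<^sup>2"
        by (simp add: power_mono)
    qed
  qed auto
  then show ?thesis
    unfolding partial sums_def c_def z_def .
qed

text \<open>By Parseval the mean of the modulus of p(1/f) is the series of the terms
  \<open>c m * r powi (2 * m - N)\<close>, and it decreases in r. The terms with m at least M have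
  nonnegative exponents and increase, so the remaining finite sum must decrease; its derivative at 1
  is the asserted expression. Nonconstancy of p keeps every p - v nonzero.\<close>

lemma area_inequality:
  fixes p :: "complex poly"
  assumes f: "f \<in> class_S" and p: "degree p > 0"
    and K: "K holomorphic_on ball 0 1"
      "\<And>z. z \<in> ball 0 1 - {0} \<Longrightarrow> (K z)\<^sup>2 = z ^ N * poly p (1 / f z)"
    and M: "N \<le> 2 * M"
  shows "(\<Sum>m<M. (2 * real m - real N) * (cmod (fps_nth (fps_expansion K 0) m))\<^sup>2) \<le> 0"
proof -
  define c where "c m = (cmod (fps_nth (fps_expansion K 0) m))\<^sup>2" for m
  have c0: "c m \<ge> 0" for m by (simp add: c_def)
  \<comment> \<open>Unlike the full series, this finite sum makes sense at and beyond x = 1, so it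
    can be differentiated there.\<close>
  define P where "P x = (\<Sum>m<M. c m * x powi (2 * int m - int N))" for x :: real
  have mean: "(\<lambda>m. c m * r powi (2 * int m - int N)) sums (LINT t|circ. cmod (poly p (1 / f (of_real r * turn t))))"
    if r: "0 < r" "r < 1" for r
  proof -
    have "(LINT t|circ. (cmod (K (of_real r * turn t)))\<^sup>2) = (LINT t|circ. r ^ N * cmod (poly p (1 / f (of_real r * turn t))))"
    proof (rule Bochner_Integration.integral_cong)
      fix t
      have "of_real r * turn t \<in> ball 0 1 - {0}" using r by (simp add: norm_mult)
      from arg_cong[OF K(2)[OF this], of cmod]
      show "(cmod (K (of_real r * turn t)))\<^sup>2 = r ^ N * cmod (poly p (1 / f (of_real r * turn t)))"
        using r by (simp add: norm_mult norm_power)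
    qed simp
    also have "\<dots> = r ^ N * (LINT t|circ. cmod (poly p (1 / f (of_real r * turn t))))" by simp
    finally have "(\<lambda>m. c m * r ^ (2 * m)) sums (r ^ N * (LINT t|circ. cmod (poly p (1 / f (of_real r * turn t)))))"
      using circ_Parseval[OF K(1) r] by (simp add: c_def)
    from sums_mult[OF this, of "inverse (r ^ N)"]
    have "(\<lambda>m. inverse (r ^ N) * (c m * r ^ (2 * m))) sums (LINT t|circ. cmod (poly p (1 / f (of_real r * turn t))))"
      using r by (simp add: mult.assoc[symmetric])
    moreover have "inverse (r ^ N) * (c m * r ^ (2 * m)) = c m * r powi (2 * int m - int N)" for m
    proof -
      have "r powi (2 * int m - int N) = r powi int (2 * m) / r powi int N"
        using r by (subst power_int_diff[symmetric]) auto
      then show ?thesis by (simp only: power_int_of_nat) (simp add: field_simps)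
    qed
    ultimately show ?thesis by simp
  qed
  have dec: "P r2 \<le> P r1" if r: "0 < r1" "r1 < r2" "r2 < 1" for r1 r2
  proof -
    have E: "ln_mean_decreasing (\<lambda>z. poly p (1 / f z) - v)" for v
    proof -
      have "p - [:v:] \<noteq> 0" using p by auto
      from ln_mean_decreasing_poly_inverse_class_S[OF f this] show ?thesis by simp
    qed
    define d where "d m = c m * r2 powi (2 * int m - int N) - c m * r1 powi (2 * int m - int N)" for m
    have sd: "d sums ((LINT t|circ. cmod (poly p (1 / f (of_real r2 * turn t)))) - (LINT t|circ. cmod (poly p (1 / f (of_real r1 * turn t)))))"
      unfolding d_def by (intro sums_diff mean) (use r in auto)
    have "(\<Sum>m<M. d m) \<le> suminf d"
    proof (rule sum_le_suminf)
      show "0 \<le> d m" if "m \<in> - {..<M}" for m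
      proof -
        have "r1 powi (2 * int m - int N) \<le> r2 powi (2 * int m - int N)"
          by (rule power_int_mono) (use that M r in auto)
        then show ?thesis using c0[of m] by (simp add: d_def mult_left_mono)
      qed
    qed (use sd in \<open>auto simp: sums_iff\<close>)
    also have "\<dots> \<le> 0"
      using circ_mean_norm_decreasing[OF E, of r1 r2] r sd by (simp add: sums_iff)
    finally show ?thesis by (simp add: P_def d_def sum_subtractf)
  qed
  have derP: "(P has_real_derivative (\<Sum>m<M. (2 * real m - real N) * c m)) (at 1)"
    unfolding P_def by (auto intro!: derivative_eq_intros sum.cong simp: mult_ac)
  have P1: "P 1 \<le> P r" if r: "0 < r" "r < 1" for r
  proof (rule tendsto_upperbound)
    show "(P \<longlongrightarrow> P 1) (at_left 1)"
      using DERIV_isCont[OF derP] unfolding isCont_def by (rule filterlim_mono) (auto simp: at_within_le_at)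
    show "eventually (\<lambda>x. P x \<le> P r) (at_left 1)"
      using eventually_at_left_real[OF r(2)] by eventually_elim (use dec r in auto)
  qed auto
  have "\<not> 0 < (\<Sum>m<M. (2 * real m - real N) * c m)"
  proof
    assume "0 < (\<Sum>m<M. (2 * real m - real N) * c m)"
    from DERIV_pos_inc_left[OF derP this] obtain d where d: "d > 0" "\<And>h. 0 < h \<Longrightarrow> h < d \<Longrightarrow> P (1 - h) < P 1" by blast
    define h where "h = min (d / 2) (1 / 2)"
    have "0 < h" "h < d" "h < 1" using d(1) by (auto simp: h_def)
    with d(2)[of h] P1[of "1 - h"] show False by simp
  qed
  then show ?thesis by (simp add: c_def)
qed

section \<open>The square root factor and its area inequality\<close>

lemma class_S_sqrt_factor:
  assumes f: "f \<in> class_S"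
  obtains s where "s holomorphic_on ball 0 1" "s 0 = 1"
    "\<And>z. z \<in> ball 0 1 \<Longrightarrow> f z = z * (s z)\<^sup>2" "\<And>z. z \<in> ball 0 1 \<Longrightarrow> s z \<noteq> 0"
proof -
  obtain q where q: "q holomorphic_on ball 0 1" "q 0 = 1"
    "\<And>z. z \<in> ball 0 1 \<Longrightarrow> f z = z * q z" "\<And>z. z \<in> ball 0 1 \<Longrightarrow> q z \<noteq> 0"
    by (rule class_S_factor[OF f]) (rule that)
  obtain g where g: "g holomorphic_on ball 0 1" "\<And>z. z \<in> ball 0 1 \<Longrightarrow> q z = exp (g z)"
    using holomorphic_log_ball[OF q(1,4)] by metis
  define s where "s z = exp ((g z - g 0) / 2)" for z
  have "(s z)\<^sup>2 = q z" if "z \<in> ball 0 1" for z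
  proof -
    have "(s z)\<^sup>2 = exp (2 * ((g z - g 0) / 2))"
      by (simp only: s_def exp_double)
    also have "2 * ((g z - g 0) / 2) = g z - g 0"
      by (simp add: field_simps)
    also have "exp (g z - g 0) = exp (g z) / exp (g 0)"
      by (rule exp_diff)
    also have "exp (g 0) = 1" using g(2)[of 0] q(2) by simp
    finally show ?thesis using g(2)[OF that] by simp
  qed
  moreover have "s holomorphic_on ball 0 1"
    unfolding s_def by (intro holomorphic_intros g(1)) auto
  ultimately show ?thesis
    by (intro that[of s]) (use q(3) in \<open>auto simp: s_def\<close>)
qed

lemma holomorphic_ball_has_fps_expansion:
  "h holomorphic_on ball 0 1 \<Longrightarrow> h has_fps_expansion fps_expansion h 0"
  by (intro has_fps_expansion_fps_expansion[of "ball 0 1"]) auto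

text \<open>The area inequality for polynomials of the form w (x1 + x3 w)^2 in w = 1/f = 1/(z s^2).
  Multiplied by z^3 they become the square of x1 z/s + x3/s^3. The seven coefficients kept involve f
  up to its term z^7.\<close>

lemma class_S_area_fps:
  assumes f: "f \<in> class_S"
  obtains \<sigma> where "fps_nth \<sigma> 0 = 1" "fps_expansion f 0 = fps_X * \<sigma>\<^sup>2"
    "\<And>x1 x3. (\<Sum>m<7. (2 * real m - 3) *
       (cmod (fps_nth (fps_const x1 * fps_X * inverse \<sigma> + fps_const x3 * inverse \<sigma> ^ 3) m))\<^sup>2) \<le> 0"
proof -
  obtain s where s: "s holomorphic_on ball 0 1" "s 0 = 1"
    "\<And>z. z \<in> ball 0 1 \<Longrightarrow> f z = z * (s z)\<^sup>2" "\<And>z. z \<in> ball 0 1 \<Longrightarrow> s z \<noteq> 0"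
    by (rule class_S_sqrt_factor[OF f]) (rule that)
  define \<sigma> where "\<sigma> = fps_expansion s 0"
  have hs: "s has_fps_expansion \<sigma>"
    unfolding \<sigma>_def by (rule holomorphic_ball_has_fps_expansion[OF s(1)])
  have \<sigma>0: "fps_nth \<sigma> 0 = 1"
    using has_fps_expansion_imp_0_eq_fps_nth_0[OF hs] s(2) by simp
  have "(\<lambda>z. z * (s z)\<^sup>2) has_fps_expansion fps_X * \<sigma>\<^sup>2"
    by (intro fps_expansion_intros hs)
  moreover have "eventually (\<lambda>z::complex. z \<in> ball 0 1) (nhds 0)"
    by (intro eventually_nhds_in_open) auto
  then have "eventually (\<lambda>z. z * (s z)\<^sup>2 = f z) (nhds 0)"
    by eventually_elim (simp add: s(3))
  ultimately have "f has_fps_expansion fps_X * \<sigma>\<^sup>2"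
    by (simp add: has_fps_expansion_cong)
  then have fexp: "fps_expansion f 0 = fps_X * \<sigma>\<^sup>2"
    by (rule fps_expansion_eqI)
  have "(\<Sum>m<7. (2 * real m - 3) *
       (cmod (fps_nth (fps_const x1 * fps_X * inverse \<sigma> + fps_const x3 * inverse \<sigma> ^ 3) m))\<^sup>2) \<le> 0" for x1 x3
  \<comment> \<open>If both vanish, p is 0 and the degree hypothesis of
    \<open>area_inequality\<close> fails.\<close>
  proof (cases "x1 = 0 \<and> x3 = 0")
    case True
    then show ?thesis by simp
  next
    case False
    define K where "K z = x1 * z * inverse (s z) + x3 * inverse (s z) ^ 3" for z
    have holK: "K holomorphic_on ball 0 1"
      unfolding K_def using s by (auto intro!: holomorphic_intros)
    have "K has_fps_expansion fps_const x1 * fps_X * inverse \<sigma> + fps_const x3 * inverse \<sigma> ^ 3"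
      unfolding K_def by (intro fps_expansion_intros hs) (simp_all add: \<sigma>0)
    then have Kexp: "fps_expansion K 0 = fps_const x1 * fps_X * inverse \<sigma> + fps_const x3 * inverse \<sigma> ^ 3"
      by (rule fps_expansion_eqI)
    define p where "p = [:0, 1:] * [:x1, x3:]\<^sup>2"
    have "[:x1, x3:] \<noteq> 0" using False by auto
    then have "degree p = 1 + degree ([:x1, x3:]\<^sup>2)"
      unfolding p_def by (subst degree_mult_eq) auto
    then have "degree p > 0" by simp
    moreover have "(K z)\<^sup>2 = z ^ 3 * poly p (1 / f z)" if "z \<in> ball 0 1 - {0}" for z
    proof -
      have z: "z \<in> ball 0 1" "z \<noteq> 0" using that by auto
      have "s z \<noteq> 0" by (rule s(4)[OF z(1)])
      then show ?thesis
        using z(2) unfolding K_def p_def s(3)[OF z(1)]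
        by (simp add: field_simps power2_eq_square power3_eq_cube)
    qed
    ultimately have "(\<Sum>m<7. (2 * real m - real 3) * (cmod (fps_nth (fps_expansion K 0) m))\<^sup>2) \<le> 0"
      using holK by (intro area_inequality[OF f, of p]) auto
    then show ?thesis by (simp add: Kexp)
  qed
  then show ?thesis using that \<sigma>0 fexp by blast
qed

section \<open>Coefficients of the function and of its inverse\<close>

lemma fps_mult_nth_upto_6:
  fixes a b :: "'a::comm_ring_1 fps"
  shows "fps_nth (a * b) 1 = fps_nth a 0 * fps_nth b 1 + fps_nth a 1 * fps_nth b 0"
    "fps_nth (a * b) 2 = fps_nth a 0 * fps_nth b 2 + fps_nth a 1 * fps_nth b 1 + fps_nth a 2 * fps_nth b 0"
    "fps_nth (a * b) 3 = fps_nth a 0 * fps_nth b 3 + fps_nth a 1 * fps_nth b 2 + fps_nth a 2 * fps_nth b 1 + fps_nth a 3 * fps_nth b 0"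
    "fps_nth (a * b) 4 = fps_nth a 0 * fps_nth b 4 + fps_nth a 1 * fps_nth b 3 + fps_nth a 2 * fps_nth b 2 + fps_nth a 3 * fps_nth b 1 + fps_nth a 4 * fps_nth b 0"
    "fps_nth (a * b) 5 = fps_nth a 0 * fps_nth b 5 + fps_nth a 1 * fps_nth b 4 + fps_nth a 2 * fps_nth b 3 + fps_nth a 3 * fps_nth b 2 + fps_nth a 4 * fps_nth b 1 + fps_nth a 5 * fps_nth b 0"
    "fps_nth (a * b) 6 = fps_nth a 0 * fps_nth b 6 + fps_nth a 1 * fps_nth b 5 + fps_nth a 2 * fps_nth b 4 + fps_nth a 3 * fps_nth b 3 + fps_nth a 4 * fps_nth b 2 + fps_nth a 5 * fps_nth b 1 + fps_nth a 6 * fps_nth b 0"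
  by (simp_all add: fps_mult_nth numeral_eq_Suc)

text \<open>The cube clears the denominators in the area series, and the even powers arise from
  composition with \<open>fps_X * \<sigma> ^ 2\<close>, whose i-th power contributes
  \<open>\<sigma> ^ (2 * i)\<close>.\<close>

lemma fps_power_nth_upto_6:
  fixes \<sigma> :: "complex fps"
  assumes s0: "fps_nth \<sigma> 0 = 1"
    and s: "fps_nth \<sigma> 1 = p1" "fps_nth \<sigma> 2 = p2" "fps_nth \<sigma> 3 = p3" "fps_nth \<sigma> 4 = p4" "fps_nth \<sigma> 5 = p5" "fps_nth \<sigma> 6 = p6"
  shows "fps_nth (\<sigma> ^ 2) 1 = 2 * p1"
    "fps_nth (\<sigma> ^ 2) 2 = p1 ^ 2 + 2 * p2"
    "fps_nth (\<sigma> ^ 2) 3 = 2 * p3 + 2 * p1 * p2"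
    "fps_nth (\<sigma> ^ 2) 4 = p2 ^ 2 + 2 * p4 + 2 * p1 * p3"
    "fps_nth (\<sigma> ^ 2) 5 = 2 * p5 + 2 * p1 * p4 + 2 * p2 * p3"
    "fps_nth (\<sigma> ^ 2) 6 = p3 ^ 2 + 2 * p6 + 2 * p1 * p5 + 2 * p2 * p4"
    "fps_nth (\<sigma> ^ 3) 1 = 3 * p1"
    "fps_nth (\<sigma> ^ 3) 2 = 3 * p1 ^ 2 + 3 * p2"
    "fps_nth (\<sigma> ^ 3) 3 = p1 ^ 3 + 3 * p3 + 6 * p1 * p2"
    "fps_nth (\<sigma> ^ 3) 4 = 3 * p2 ^ 2 + 3 * p4 + 6 * p1 * p3 + 3 * p1 ^ 2 * p2"
    "fps_nth (\<sigma> ^ 3) 5 = 3 * p5 + 3 * p1 * p2 ^ 2 + 6 * p1 * p4 + 3 * p1 ^ 2 * p3 + 6 * p2 * p3"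
    "fps_nth (\<sigma> ^ 3) 6 = p2 ^ 3 + 3 * p3 ^ 2 + 3 * p6 + 6 * p1 * p5 + 3 * p1 ^ 2 * p4 + 6 * p2 * p4 + 6 * p1 * p2 * p3"
    "fps_nth (\<sigma> ^ 4) 1 = 4 * p1"
    "fps_nth (\<sigma> ^ 4) 2 = 6 * p1 ^ 2 + 4 * p2"
    "fps_nth (\<sigma> ^ 4) 3 = 4 * p1 ^ 3 + 4 * p3 + 12 * p1 * p2"
    "fps_nth (\<sigma> ^ 4) 4 = p1 ^ 4 + 6 * p2 ^ 2 + 4 * p4 + 12 * p1 * p3 + 12 * p1 ^ 2 * p2"
    "fps_nth (\<sigma> ^ 6) 1 = 6 * p1"
    "fps_nth (\<sigma> ^ 6) 2 = 15 * p1 ^ 2 + 6 * p2"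
    "fps_nth (\<sigma> ^ 6) 3 = 20 * p1 ^ 3 + 6 * p3 + 30 * p1 * p2"
    "fps_nth (\<sigma> ^ 8) 1 = 8 * p1"
    "fps_nth (\<sigma> ^ 8) 2 = 28 * p1 ^ 2 + 8 * p2"
    "fps_nth (\<sigma> ^ 10) 1 = 10 * p1"
proof -
  note nth = fps_mult_nth_upto_6 fps_power_zeroth
  have d2: "\<sigma> ^ 2 = \<sigma> * \<sigma>"
    by algebra
  show c2: "fps_nth (\<sigma> ^ 2) 1 = 2 * p1"
    "fps_nth (\<sigma> ^ 2) 2 = p1 ^ 2 + 2 * p2"
    "fps_nth (\<sigma> ^ 2) 3 = 2 * p3 + 2 * p1 * p2"
    "fps_nth (\<sigma> ^ 2) 4 = p2 ^ 2 + 2 * p4 + 2 * p1 * p3"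
    "fps_nth (\<sigma> ^ 2) 5 = 2 * p5 + 2 * p1 * p4 + 2 * p2 * p3"
    "fps_nth (\<sigma> ^ 2) 6 = p3 ^ 2 + 2 * p6 + 2 * p1 * p5 + 2 * p2 * p4"
    unfolding d2 nth s0 s 
    by (simp_all add: s0 algebra_simps power2_eq_square power3_eq_cube eval_nat_numeral)
  have d3: "\<sigma> ^ 3 = \<sigma> * \<sigma> ^ 2"
    by algebra
  show c3: "fps_nth (\<sigma> ^ 3) 1 = 3 * p1"
    "fps_nth (\<sigma> ^ 3) 2 = 3 * p1 ^ 2 + 3 * p2"
    "fps_nth (\<sigma> ^ 3) 3 = p1 ^ 3 + 3 * p3 + 6 * p1 * p2"
    "fps_nth (\<sigma> ^ 3) 4 = 3 * p2 ^ 2 + 3 * p4 + 6 * p1 * p3 + 3 * p1 ^ 2 * p2"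
    "fps_nth (\<sigma> ^ 3) 5 = 3 * p5 + 3 * p1 * p2 ^ 2 + 6 * p1 * p4 + 3 * p1 ^ 2 * p3 + 6 * p2 * p3"
    "fps_nth (\<sigma> ^ 3) 6 = p2 ^ 3 + 3 * p3 ^ 2 + 3 * p6 + 6 * p1 * p5 + 3 * p1 ^ 2 * p4 + 6 * p2 * p4 + 6 * p1 * p2 * p3"
    unfolding d3 nth s0 s c2 
    by (simp_all add: s0 algebra_simps power2_eq_square power3_eq_cube eval_nat_numeral)
  have d4: "\<sigma> ^ 4 = \<sigma> ^ 2 * \<sigma> ^ 2"
    by algebra
  show c4: "fps_nth (\<sigma> ^ 4) 1 = 4 * p1"
    "fps_nth (\<sigma> ^ 4) 2 = 6 * p1 ^ 2 + 4 * p2"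
    "fps_nth (\<sigma> ^ 4) 3 = 4 * p1 ^ 3 + 4 * p3 + 12 * p1 * p2"
    "fps_nth (\<sigma> ^ 4) 4 = p1 ^ 4 + 6 * p2 ^ 2 + 4 * p4 + 12 * p1 * p3 + 12 * p1 ^ 2 * p2"
    unfolding d4 nth s0 s c2 
    by (simp_all add: s0 algebra_simps power2_eq_square power3_eq_cube eval_nat_numeral)
  have d6: "\<sigma> ^ 6 = \<sigma> ^ 2 * \<sigma> ^ 4"
    by algebra
  show c6: "fps_nth (\<sigma> ^ 6) 1 = 6 * p1"
    "fps_nth (\<sigma> ^ 6) 2 = 15 * p1 ^ 2 + 6 * p2"
    "fps_nth (\<sigma> ^ 6) 3 = 20 * p1 ^ 3 + 6 * p3 + 30 * p1 * p2"
    unfolding d6 nth s0 s c2 c4 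
    by (simp_all add: s0 algebra_simps power2_eq_square power3_eq_cube eval_nat_numeral)
  have d8: "\<sigma> ^ 8 = \<sigma> ^ 2 * \<sigma> ^ 6"
    by algebra
  show c8: "fps_nth (\<sigma> ^ 8) 1 = 8 * p1"
    "fps_nth (\<sigma> ^ 8) 2 = 28 * p1 ^ 2 + 8 * p2"
    unfolding d8 nth s0 s c2 c4 c6 
    by (simp_all add: s0 algebra_simps power2_eq_square power3_eq_cube eval_nat_numeral)
  have d10: "\<sigma> ^ 10 = \<sigma> ^ 2 * \<sigma> ^ 8"
    by algebra
  show c10: "fps_nth (\<sigma> ^ 10) 1 = 10 * p1"
    unfolding d10 nth s0 s c2 c4 c6 c8 
    by (simp_all add: s0 algebra_simps power2_eq_square power3_eq_cube eval_nat_numeral)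
qed

text \<open>The factor \<open>1 + 3 * p1 * m\<close> cancels the contribution of
  \<open>m * inverse \<sigma> ^ 3\<close> to the linear coefficient. The two coefficients with
  negative weight are then the constants m and 1, and all the others enter the area inequality with
  positive weight.\<close>

lemma area_fps_nth:
  fixes \<sigma> A :: "complex fps"
  assumes s0: "fps_nth \<sigma> 0 = 1"
    and s: "fps_nth \<sigma> 1 = p1" "fps_nth \<sigma> 2 = p2" "fps_nth \<sigma> 3 = p3" "fps_nth \<sigma> 4 = p4" "fps_nth \<sigma> 5 = p5" "fps_nth \<sigma> 6 = p6"
    and A: "A = fps_const (1 + 3 * p1 * m) * fps_X * inverse \<sigma> + fps_const m * inverse \<sigma> ^ 3"
  shows "fps_nth A 0 = m" "fps_nth A 1 = 1"
    "fps_nth A 2 = - (p1) + 3 * m * p1 ^ 2 - 3 * m * p2"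
    "fps_nth A 3 = p1 ^ 2 - p2 - 7 * m * p1 ^ 3 - 3 * m * p3 + 9 * m * p1 * p2"
    "fps_nth A 4 = - (p1 ^ 3) - p3 + 12 * m * p1 ^ 4 + 6 * m * p2 ^ 2 - 3 * m * p4 + 2 * p1 * p2 + 9 * m * p1 * p3 - 24 * m * p1 ^ 2 * p2"
    "fps_nth A 5 = p1 ^ 4 + p2 ^ 2 - p4 - 18 * m * p1 ^ 5 - 3 * m * p5 + 2 * p1 * p3 - 3 * p1 ^ 2 * p2 - 27 * m * p1 * p2 ^ 2 + 9 * m * p1 * p4 - 24 * m * p1 ^ 2 * p3 + 51 * m * p1 ^ 3 * p2 + 12 * m * p2 * p3"
    "fps_nth A 6 = - (p1 ^ 5) - p5 + 25 * m * p1 ^ 6 - 10 * m * p2 ^ 3 + 6 * m * p3 ^ 2 - 3 * m * p6 - 3 * p1 * p2 ^ 2 + 2 * p1 * p4 - 3 * p1 ^ 2 * p3 + 4 * p1 ^ 3 * p2 + 2 * p2 * p3 + 9 * m * p1 * p5 + 81 * m * p1 ^ 2 * p2 ^ 2 - 24 * m * p1 ^ 2 * p4 + 51 * m * p1 ^ 3 * p3 - 93 * m * p1 ^ 4 * p2 + 12 * m * p2 * p4 - 54 * m * p1 * p2 * p3"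
proof -
  have "inverse \<sigma> * \<sigma> = 1"
    by (rule inverse_mult_eq_1) (simp add: s0)
  \<comment> \<open>Multiplying by the cube turns the definition into a triangular system, solved
    one coefficient at a time.\<close>
  then have A3: "A * \<sigma> ^ 3 = fps_const (1 + 3 * p1 * m) * (fps_X * \<sigma> ^ 2) + fps_const m"
    unfolding A by algebra
  note c = fps_power_nth_upto_6[OF s0 s]
  have eq: "fps_nth (A * \<sigma> ^ 3) (Suc n) = (1 + 3 * p1 * m) * fps_nth (\<sigma> ^ 2) n" for n
    unfolding A3 by simp
  have "fps_nth (A * \<sigma> ^ 3) 0 = m"
    unfolding A3 by simp
  then show A0: "fps_nth A 0 = m"
    by (simp add: s0 fps_power_zeroth)
  have "fps_nth (A * \<sigma> ^ 3) 1 = (1 + 3 * p1 * m) * fps_nth (\<sigma> ^ 2) 0"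
    using eq[of 0] by (simp add: numeral_eq_Suc)
  then show A1: "fps_nth A 1 = 1"
    unfolding fps_mult_nth_upto_6 c fps_power_zeroth s0 power_one A0 by algebra
  have "fps_nth (A * \<sigma> ^ 3) 2 = (1 + 3 * p1 * m) * fps_nth (\<sigma> ^ 2) 1"
    using eq[of 1] by (simp add: numeral_eq_Suc)
  then show A2: "fps_nth A 2 = - (p1) + 3 * m * p1 ^ 2 - 3 * m * p2"
    unfolding fps_mult_nth_upto_6 c fps_power_zeroth s0 power_one A0 A1 by algebra
  have "fps_nth (A * \<sigma> ^ 3) 3 = (1 + 3 * p1 * m) * fps_nth (\<sigma> ^ 2) 2"
    using eq[of 2] by (simp add: numeral_eq_Suc)
  then show A3: "fps_nth A 3 = p1 ^ 2 - p2 - 7 * m * p1 ^ 3 - 3 * m * p3 + 9 * m * p1 * p2"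
    unfolding fps_mult_nth_upto_6 c fps_power_zeroth s0 power_one A0 A1 A2 by algebra
  have "fps_nth (A * \<sigma> ^ 3) 4 = (1 + 3 * p1 * m) * fps_nth (\<sigma> ^ 2) 3"
    using eq[of 3] by (simp add: numeral_eq_Suc)
  then show A4: "fps_nth A 4 = - (p1 ^ 3) - p3 + 12 * m * p1 ^ 4 + 6 * m * p2 ^ 2 - 3 * m * p4 + 2 * p1 * p2 + 9 * m * p1 * p3 - 24 * m * p1 ^ 2 * p2"
    unfolding fps_mult_nth_upto_6 c fps_power_zeroth s0 power_one A0 A1 A2 A3 by algebra
  have "fps_nth (A * \<sigma> ^ 3) 5 = (1 + 3 * p1 * m) * fps_nth (\<sigma> ^ 2) 4"
    using eq[of 4] by (simp add: numeral_eq_Suc)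
  then show A5: "fps_nth A 5 = p1 ^ 4 + p2 ^ 2 - p4 - 18 * m * p1 ^ 5 - 3 * m * p5 + 2 * p1 * p3 - 3 * p1 ^ 2 * p2 - 27 * m * p1 * p2 ^ 2 + 9 * m * p1 * p4 - 24 * m * p1 ^ 2 * p3 + 51 * m * p1 ^ 3 * p2 + 12 * m * p2 * p3"
    unfolding fps_mult_nth_upto_6 c fps_power_zeroth s0 power_one A0 A1 A2 A3 A4 by algebra
  have "fps_nth (A * \<sigma> ^ 3) 6 = (1 + 3 * p1 * m) * fps_nth (\<sigma> ^ 2) 5"
    using eq[of 5] by (simp add: numeral_eq_Suc)
  then show A6: "fps_nth A 6 = - (p1 ^ 5) - p5 + 25 * m * p1 ^ 6 - 10 * m * p2 ^ 3 + 6 * m * p3 ^ 2 - 3 * m * p6 - 3 * p1 * p2 ^ 2 + 2 * p1 * p4 - 3 * p1 ^ 2 * p3 + 4 * p1 ^ 3 * p2 + 2 * p2 * p3 + 9 * m * p1 * p5 + 81 * m * p1 ^ 2 * p2 ^ 2 - 24 * m * p1 ^ 2 * p4 + 51 * m * p1 ^ 3 * p3 - 93 * m * p1 ^ 4 * p2 + 12 * m * p2 * p4 - 54 * m * p1 * p2 * p3"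
    unfolding fps_mult_nth_upto_6 c fps_power_zeroth s0 power_one A0 A1 A2 A3 A4 A5 by algebra
qed

text \<open>Since \<open>\<tau>\<close> is determined by \<open>\<sigma>\<close> through \<open>\<sigma> (\<tau> \<circ> X \<sigma>\<^sup>2) = 1\<close>, composing with \<open>X \<sigma>\<^sup>2\<close> yields a
  triangular linear system for the coefficients of \<open>B\<close>.\<close>

lemma area_fps_inverse_nth:
  fixes \<sigma> \<tau> B :: "complex fps"
  assumes s0: "fps_nth \<sigma> 0 = 1" "fps_nth \<tau> 0 = 1"
    and s: "fps_nth \<sigma> 1 = p1" "fps_nth \<sigma> 2 = p2" "fps_nth \<sigma> 3 = p3" "fps_nth \<sigma> 4 = p4" "fps_nth \<sigma> 5 = p5" "fps_nth \<sigma> 6 = p6"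
    and inv: "(fps_X * \<tau> ^ 2) oo (fps_X * \<sigma> ^ 2) = fps_X"
    and B: "B = fps_const (1 + 3 * p1 * m) * fps_X * inverse \<tau> - fps_const m * inverse \<tau> ^ 3"
  shows "fps_nth B 0 = - m" "fps_nth B 1 = 1"
    "fps_nth B 2 = p1 + 6 * m * p1 ^ 2 - 3 * m * p2"
    "fps_nth B 3 = - (2 * p1 ^ 2) + p2 - 16 * m * p1 ^ 3 - 3 * m * p3 + 15 * m * p1 * p2"
    "fps_nth B 4 = 7 * p1 ^ 3 + p3 + 63 * m * p1 ^ 4 + 9 * m * p2 ^ 2 - 3 * m * p4 - 6 * p1 * p2 + 21 * m * p1 * p3 - 81 * m * p1 ^ 2 * p2"
    "fps_nth B 5 = - (30 * p1 ^ 4) - 4 * p2 ^ 2 + p4 - 288 * m * p1 ^ 5 - 3 * m * p5 - 8 * p1 * p3 + 36 * p1 ^ 2 * p2 - 120 * m * p1 * p2 ^ 2 + 27 * m * p1 * p4 - 132 * m * p1 ^ 2 * p3 + 468 * m * p1 ^ 3 * p2 + 24 * m * p2 * p3"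
    "fps_nth B 6 = 143 * p1 ^ 5 + p5 + 1430 * m * p1 ^ 6 - 55 * m * p2 ^ 3 + 15 * m * p3 ^ 2 - 3 * m * p6 + 55 * p1 * p2 ^ 2 - 10 * p1 * p4 + 55 * p1 ^ 2 * p3 - 220 * p1 ^ 3 * p2 - 10 * p2 * p3 + 33 * m * p1 * p5 + 1155 * m * p1 ^ 2 * p2 ^ 2 - 195 * m * p1 ^ 2 * p4 + 825 * m * p1 ^ 3 * p3 - 2805 * m * p1 ^ 4 * p2 + 30 * m * p2 * p4 - 360 * m * p1 * p2 * p3"
proof -
  let ?f = "fps_X * \<sigma> ^ 2"
  have f0: "fps_nth ?f 0 = 0" by simp
  \<comment> \<open>The inverse relation determines only the square of this series; its constant
    term 1 fixes the sign.\<close>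
  define \<rho> where "\<rho> = \<sigma> * (\<tau> oo ?f)"
  have \<rho>0: "fps_nth \<rho> 0 = 1"
    by (simp add: \<rho>_def s0)
  have "fps_X * \<rho> ^ 2 = (fps_X * \<tau> ^ 2) oo ?f"
    unfolding \<rho>_def by (simp add: fps_compose_mult_distrib[OF f0] fps_compose_power[OF f0, symmetric] f0 power_mult_distrib mult_ac)
  then have "\<rho> ^ 2 = 1"
    using inv by simp
  then have "\<rho> = 1 \<or> \<rho> = - 1"
    by (simp add: power2_eq_1_iff)
  moreover have "\<rho> \<noteq> - 1"
    using \<rho>0 by auto
  ultimately have \<rho>: "\<sigma> * (\<tau> oo ?f) = 1"
    by (simp add: \<rho>_def)
  have "inverse \<tau> * \<tau> = 1"
    by (rule inverse_mult_eq_1) (simp add: s0)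
  then have "(inverse \<tau> oo ?f) * (\<tau> oo ?f) = 1"
    using fps_compose_mult_distrib[OF f0, of "inverse \<tau>" \<tau>] by simp
  with \<rho> have i: "inverse \<tau> oo ?f = \<sigma>"
    by algebra
  have Bf: "B oo ?f = fps_const (1 + 3 * p1 * m) * (fps_X * \<sigma> ^ 3) - fps_const m * \<sigma> ^ 3"
  proof -
    have "B oo ?f = fps_const (1 + 3 * p1 * m) * ?f * \<sigma> - fps_const m * \<sigma> ^ 3"
      unfolding B fps_compose_sub_distrib fps_compose_mult_distrib[OF f0] fps_compose_power[OF f0, symmetric] i
      by (simp add: f0)
    then show ?thesis by algebra
  qed
  note c = fps_power_nth_upto_6[OF s0(1) s]
  have lhs: "fps_nth (B oo ?f) n = (\<Sum>i=0..n. fps_nth B i * fps_nth (\<sigma> ^ (2 * i)) (n - i))" for n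
    unfolding fps_compose_nth by (intro sum.cong) (auto simp: power_mult_distrib fps_X_power_mult_nth power_mult)
  have rhs: "fps_nth (B oo ?f) (Suc n) = (1 + 3 * p1 * m) * fps_nth (\<sigma> ^ 3) n - m * fps_nth (\<sigma> ^ 3) (Suc n)" for n
    unfolding Bf by simp
  have "fps_nth (B oo ?f) 0 = - m"
    unfolding Bf by (simp add: s0 fps_power_zeroth)
  then show B0: "fps_nth B 0 = - m"
    by simp
  have "fps_nth B 1 * fps_nth (\<sigma> ^ 2) 0 =
      (1 + 3 * p1 * m) * fps_nth (\<sigma> ^ 3) 0 - m * fps_nth (\<sigma> ^ 3) 1"
    using rhs[of 0] unfolding lhs by (simp add: numeral_eq_Suc)
  then show B1: "fps_nth B 1 = 1"
    unfolding c fps_power_zeroth s0 power_one B0 by algebra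
  have "fps_nth B 1 * fps_nth (\<sigma> ^ 2) 1 + fps_nth B 2 * fps_nth (\<sigma> ^ 4) 0 =
      (1 + 3 * p1 * m) * fps_nth (\<sigma> ^ 3) 1 - m * fps_nth (\<sigma> ^ 3) 2"
    using rhs[of 1] unfolding lhs by (simp add: numeral_eq_Suc)
  then show B2: "fps_nth B 2 = p1 + 6 * m * p1 ^ 2 - 3 * m * p2"
    unfolding c fps_power_zeroth s0 power_one B0 B1 by algebra
  have "fps_nth B 1 * fps_nth (\<sigma> ^ 2) 2 + fps_nth B 2 * fps_nth (\<sigma> ^ 4) 1 + fps_nth B 3 * fps_nth (\<sigma> ^ 6) 0 =
      (1 + 3 * p1 * m) * fps_nth (\<sigma> ^ 3) 2 - m * fps_nth (\<sigma> ^ 3) 3"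
    using rhs[of 2] unfolding lhs by (simp add: numeral_eq_Suc)
  then show B3: "fps_nth B 3 = - (2 * p1 ^ 2) + p2 - 16 * m * p1 ^ 3 - 3 * m * p3 + 15 * m * p1 * p2"
    unfolding c fps_power_zeroth s0 power_one B0 B1 B2 by algebra
  have "fps_nth B 1 * fps_nth (\<sigma> ^ 2) 3 + fps_nth B 2 * fps_nth (\<sigma> ^ 4) 2 + fps_nth B 3 * fps_nth (\<sigma> ^ 6) 1 + fps_nth B 4 * fps_nth (\<sigma> ^ 8) 0 =
      (1 + 3 * p1 * m) * fps_nth (\<sigma> ^ 3) 3 - m * fps_nth (\<sigma> ^ 3) 4"
    using rhs[of 3] unfolding lhs by (simp add: numeral_eq_Suc)
  then show B4: "fps_nth B 4 = 7 * p1 ^ 3 + p3 + 63 * m * p1 ^ 4 + 9 * m * p2 ^ 2 - 3 * m * p4 - 6 * p1 * p2 + 21 * m * p1 * p3 - 81 * m * p1 ^ 2 * p2"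
    unfolding c fps_power_zeroth s0 power_one B0 B1 B2 B3 by algebra
  have "fps_nth B 1 * fps_nth (\<sigma> ^ 2) 4 + fps_nth B 2 * fps_nth (\<sigma> ^ 4) 3 + fps_nth B 3 * fps_nth (\<sigma> ^ 6) 2 + fps_nth B 4 * fps_nth (\<sigma> ^ 8) 1 + fps_nth B 5 * fps_nth (\<sigma> ^ 10) 0 =
      (1 + 3 * p1 * m) * fps_nth (\<sigma> ^ 3) 4 - m * fps_nth (\<sigma> ^ 3) 5"
    using rhs[of 4] unfolding lhs by (simp add: numeral_eq_Suc)
  then show B5: "fps_nth B 5 = - (30 * p1 ^ 4) - 4 * p2 ^ 2 + p4 - 288 * m * p1 ^ 5 - 3 * m * p5 - 8 * p1 * p3 + 36 * p1 ^ 2 * p2 - 120 * m * p1 * p2 ^ 2 + 27 * m * p1 * p4 - 132 * m * p1 ^ 2 * p3 + 468 * m * p1 ^ 3 * p2 + 24 * m * p2 * p3"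
    unfolding c fps_power_zeroth s0 power_one B0 B1 B2 B3 B4 by algebra
  have "fps_nth B 1 * fps_nth (\<sigma> ^ 2) 5 + fps_nth B 2 * fps_nth (\<sigma> ^ 4) 4 + fps_nth B 3 * fps_nth (\<sigma> ^ 6) 3 + fps_nth B 4 * fps_nth (\<sigma> ^ 8) 2 + fps_nth B 5 * fps_nth (\<sigma> ^ 10) 1 + fps_nth B 6 * fps_nth (\<sigma> ^ 12) 0 =
      (1 + 3 * p1 * m) * fps_nth (\<sigma> ^ 3) 5 - m * fps_nth (\<sigma> ^ 3) 6"
    using rhs[of 5] unfolding lhs by (simp add: numeral_eq_Suc)
  then show B6: "fps_nth B 6 = 143 * p1 ^ 5 + p5 + 1430 * m * p1 ^ 6 - 55 * m * p2 ^ 3 + 15 * m * p3 ^ 2 - 3 * m * p6 + 55 * p1 * p2 ^ 2 - 10 * p1 * p4 + 55 * p1 ^ 2 * p3 - 220 * p1 ^ 3 * p2 - 10 * p2 * p3 + 33 * m * p1 * p5 + 1155 * m * p1 ^ 2 * p2 ^ 2 - 195 * m * p1 ^ 2 * p4 + 825 * m * p1 ^ 3 * p3 - 2805 * m * p1 ^ 4 * p2 + 30 * m * p2 * p4 - 360 * m * p1 * p2 * p3"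
    unfolding c fps_power_zeroth s0 power_one B0 B1 B2 B3 B4 B5 by algebra
qed

section \<open>Numerical estimates\<close>

text \<open>The numbers below come from the area inequality for the pair \<open>f, g\<close> at \<open>p\<^sub>1 = 37/50\<close>,
  \<open>m = 3/10\<close>. Squares are bounded below by tangent lines taken near the minimum, which is
  attained at \<open>a = e = 0\<close>.\<close>

lemma area_certificate_real:
  fixes a1 a2 g1 g2 e1 e2 d1 :: real
  defines "r5 \<equiv> 16867449/50000000 - 583/125 * g1 - 9/10 * (a1\<^sup>2 - a2\<^sup>2)"
    and "r7 \<equiv> 942702983/12500000000 - 18537/12500 * g1 + 1497/500 * (a1\<^sup>2 - a2\<^sup>2) - 9/5 * d1"
    and "r9 \<equiv> - (561894083571/250000000000) + 19602711/1250000 * g1 - 27/10 * (g1\<^sup>2 - g2\<^sup>2)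
           + 1515483/50000 * (a1\<^sup>2 - a2\<^sup>2) - 27/5 * (a1 * e1 - a2 * e2) - 916/125 * d1"
    and "h1 \<equiv> 6179/6250 * a1 + 9/5 * e1"
    and "h2 \<equiv> 6179/6250 * a2 + 9/5 * e2"
  shows "127/25 < (49321/25000)\<^sup>2 + 3 * ((532541/1250000 + 9/5 * g1)\<^sup>2 + (9/5 * g2)\<^sup>2)
     + 3 * ((833/250)\<^sup>2 * (a1\<^sup>2 + a2\<^sup>2)) + 5 * r5\<^sup>2 + 5 * (h1\<^sup>2 + h2\<^sup>2) + 7 * r7\<^sup>2 + 9 * r9\<^sup>2"
proof -
  have tangent: "2 * t * r - t\<^sup>2 \<le> r\<^sup>2" for t r :: real
    using zero_le_power2[of "r - t"] by (simp add: power2_diff mult_ac)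
  \<comment> \<open>The points of tangency make the terms in \<open>d1\<close> cancel.\<close>
  have r5: "2 * (- (9/100)) * r5 - (- (9/100))\<^sup>2 \<le> r5\<^sup>2"
    and r7: "2 * (6183/43750) * r7 - (6183/43750)\<^sup>2 \<le> r7\<^sup>2"
    and r9: "2 * (- (27/1000)) * r9 - (- (27/1000))\<^sup>2 \<le> r9\<^sup>2"
    by (rule tangent)+
  \<comment> \<open>2/25 is close to the minimizer of the quadratic in \<open>g1\<close> that
    remains after the tangent bounds.\<close>
  have g: "0 \<le> (g1 - 2/25)\<^sup>2" "0 \<le> g1\<^sup>2" "0 \<le> g2\<^sup>2" by auto
  have a: "0 \<le> (a1 + h1)\<^sup>2" "0 \<le> (a2 - h2)\<^sup>2" "0 \<le> h1\<^sup>2" "0 \<le> h2\<^sup>2" "0 \<le> a1\<^sup>2" "0 \<le> a2\<^sup>2" by auto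
  \<comment> \<open>Replacing e by h turns the indefinite products a e into products a h, which the
    squares of a and h absorb. The opposite signs in \<open>(a1 + h1)\<^sup>2\<close> and
    \<open>(a2 - h2)\<^sup>2\<close> follow those in \<open>a1 * e1 - a2 * e2\<close>.\<close>
  have e: "a1 * e1 = 5/9 * (a1 * h1) - 6179/11250 * a1\<^sup>2" "a2 * e2 = 5/9 * (a2 * h2) - 6179/11250 * a2\<^sup>2"
    by (simp_all add: h1_def h2_def power2_eq_square algebra_simps)
  have x: "(a1 + h1)\<^sup>2 = a1\<^sup>2 + 2 * (a1 * h1) + h1\<^sup>2" "(a2 - h2)\<^sup>2 = a2\<^sup>2 - 2 * (a2 * h2) + h2\<^sup>2"
    "(g1 - 2/25)\<^sup>2 = g1\<^sup>2 - 4/25 * g1 + 4/625"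
    "(532541/1250000 + 9/5 * g1)\<^sup>2 = 283599916681/1562500000000 + 4792869/3125000 * g1 + 81/25 * g1\<^sup>2"
    "(9/5 * g2)\<^sup>2 = 81/25 * g2\<^sup>2"
    by (simp_all add: power2_eq_square algebra_simps)
  have R: "r5 = 16867449/50000000 - 583/125 * g1 - 9/10 * (a1\<^sup>2 - a2\<^sup>2)"
    "r7 = 942702983/12500000000 - 18537/12500 * g1 + 1497/500 * (a1\<^sup>2 - a2\<^sup>2) - 9/5 * d1"
    "r9 = - (561894083571/250000000000) + 19602711/1250000 * g1 - 27/10 * (g1\<^sup>2 - g2\<^sup>2)
       + 1515483/50000 * (a1\<^sup>2 - a2\<^sup>2) - 27/5 * (a1 * e1 - a2 * e2) - 916/125 * d1"
    by (simp_all only: r5_def r7_def r9_def)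
  have T: "3 * ((833/250)\<^sup>2 * (a1\<^sup>2 + a2\<^sup>2)) = 2081667/62500 * a1\<^sup>2 + 2081667/62500 * a2\<^sup>2"
    by (simp add: power2_eq_square)
  have C: "(49321/25000)\<^sup>2 = (2432561041/625000000 :: real)" "(- (9/100))\<^sup>2 = (81/10000 :: real)"
    "(6183/43750)\<^sup>2 = (38229489/1914062500 :: real)" "(- (27/1000))\<^sup>2 = (729/1000000 :: real)"
    by (simp_all add: power2_eq_square)
  have K: "3285851917936923/4375000000000000 - 3973787109/625000000 * g1 + 6561/5000 * (g1\<^sup>2 - g2\<^sup>2)
      - 199917153/25000000 * (a1\<^sup>2 - a2\<^sup>2) + 6561/2500 * (a1 * e1 - a2 * e2) \<le> 5 * r5\<^sup>2 + 7 * r7\<^sup>2 + 9 * r9\<^sup>2"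
    using r5 r7 r9 R unfolding C by linarith
  show ?thesis
    using K g a unfolding x T C e by argo
qed

text \<open>The three expressions involving quadratic terms or d are replaced by their real parts;
  the linear expressions in g, a and e keep their full modulus, whose imaginary part compensates the
  negative squares arising from the real parts.\<close>

lemma area_certificate:
  fixes a g e d :: complex
  shows "127/25 < (49321/25000)\<^sup>2 + 3 * ((cmod (532541/1250000 + 9/5 * g))\<^sup>2 + (cmod (833/250 * a))\<^sup>2)
     + 5 * ((cmod (16867449/50000000 - 583/125 * g - 9/10 * a\<^sup>2))\<^sup>2 + (cmod (6179/6250 * a + 9/5 * e))\<^sup>2)
     + 7 * (cmod (942702983/12500000000 - 18537/12500 * g + 1497/500 * a\<^sup>2 - 9/5 * d))\<^sup>2
     + 9 * (cmod (- (561894083571/250000000000) + 19602711/1250000 * g - 27/10 * g\<^sup>2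
           + 1515483/50000 * a\<^sup>2 - 27/5 * (a * e) - 916/125 * d))\<^sup>2"
    (is "_ < _ + 3 * ((cmod ?s3)\<^sup>2 + (cmod ?t3)\<^sup>2) + 5 * ((cmod ?s5)\<^sup>2 + (cmod ?t5)\<^sup>2) + 7 * (cmod ?s7)\<^sup>2 + 9 * (cmod ?s9)\<^sup>2")
proof -
  have Re_le: "(Re z)\<^sup>2 \<le> (cmod z)\<^sup>2" for z by (simp add: cmod_power2)
  have n: "Re (numeral n * z) = numeral n * Re z" "Im (numeral n * z) = numeral n * Im z"
    "Re (numeral n / numeral m * z) = numeral n / numeral m * Re z"
    "Im (numeral n / numeral m * z) = numeral n / numeral m * Im z" for n m z
    by (simp_all add: Re_divide_numeral)
  have r5: "Re ?s5 = 16867449/50000000 - 583/125 * Re g - 9/10 * ((Re a)\<^sup>2 - (Im a)\<^sup>2)"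
    by (simp add: n power2_eq_square)
  have r7: "Re ?s7 = 942702983/12500000000 - 18537/12500 * Re g + 1497/500 * ((Re a)\<^sup>2 - (Im a)\<^sup>2) - 9/5 * Re d"
    by (simp add: n power2_eq_square)
  have r9: "Re ?s9 = - (561894083571/250000000000) + 19602711/1250000 * Re g - 27/10 * ((Re g)\<^sup>2 - (Im g)\<^sup>2)
       + 1515483/50000 * ((Re a)\<^sup>2 - (Im a)\<^sup>2) - 27/5 * (Re a * Re e - Im a * Im e) - 916/125 * Re d"
    by (simp add: n power2_eq_square)
  have s3: "(cmod ?s3)\<^sup>2 = (532541/1250000 + 9/5 * Re g)\<^sup>2 + (9/5 * Im g)\<^sup>2"
    unfolding cmod_power2 by (simp add: n)
  have t5: "(cmod ?t5)\<^sup>2 = (6179/6250 * Re a + 9/5 * Re e)\<^sup>2 + (6179/6250 * Im a + 9/5 * Im e)\<^sup>2"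
    unfolding cmod_power2 by (simp add: n)
  have t3: "(cmod ?t3)\<^sup>2 = (833/250)\<^sup>2 * ((Re a)\<^sup>2 + (Im a)\<^sup>2)"
    unfolding cmod_power2 by (simp add: n power2_eq_square algebra_simps)
  show ?thesis
    using area_certificate_real[where ?a1.0 = "Re a" and ?a2.0 = "Im a" and ?g1.0 = "Re g" and ?g2.0 = "Im g"
        and ?e1.0 = "Re e" and ?e2.0 = "Im e" and ?d1.0 = "Re d"]
      Re_le[of ?s5, unfolded r5] Re_le[of ?s7, unfolded r7] Re_le[of ?s9, unfolded r9]
    unfolding s3 t3 t5 by argo
qed

text \<open>The variables stand for the moduli of the first coefficients u1, u3, u5, u7 of 1/s. The
  left-hand sides are the triangle-inequality bounds for the third, fourth and fifth coefficients of
  f = z s^2.\<close>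

lemma real_coefficient_bounds:
  fixes x y z v :: real
  assumes x: "0 \<le> x" "x \<le> 37/50" and area: "x\<^sup>2 + 3 * y\<^sup>2 + 5 * z\<^sup>2 + 7 * v\<^sup>2 \<le> 1"
  shows "3 * x\<^sup>2 + 2 * y \<le> 2427/1000"
    and "4 * x ^ 3 + 6 * (x * y) + 2 * z \<le> 3461/1000"
    and "5 * x ^ 4 + 12 * (x\<^sup>2 * y) + 3 * y\<^sup>2 + 6 * (x * z) + 2 * v \<le> 4993/1000"
proof -
  have x2: "x\<^sup>2 \<le> 1369/2500" "0 \<le> x\<^sup>2"
    using power_mono[OF x(2,1), of 2] by (simp_all add: power2_eq_square)
  \<comment> \<open>The higher powers of x are reduced to multiples of its square, so that the final
    estimates are linear.\<close>
  have x3: "x ^ 3 \<le> 37/50 * x\<^sup>2"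
    using mult_right_mono[OF x(2), of "x\<^sup>2"] by (simp add: power3_eq_cube power2_eq_square mult_ac)
  have x4: "x ^ 4 \<le> 1369/2500 * x\<^sup>2"
    using mult_right_mono[OF x2] by (simp add: power4_eq_xxxx power2_eq_square mult_ac)
  have sq: "0 \<le> y\<^sup>2" "0 \<le> z\<^sup>2" "0 \<le> v\<^sup>2" by auto
  \<comment> \<open>Lagrange multipliers \<open>100/117\<close>, \<open>2\<close> and \<open>4\<close> for the area constraint.\<close>
  have "0 \<le> (y - 39/100)\<^sup>2" by simp
  then have "2 * y \<le> 100/39 * y\<^sup>2 + 39/100"
    by (simp add: power2_eq_square algebra_simps)
  then show "3 * x\<^sup>2 + 2 * y \<le> 2427/1000"
    using area x2 sq by linarith
  have "0 \<le> 6 * (y - x/2)\<^sup>2" "0 \<le> 10 * (z - 1/10)\<^sup>2" by auto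
  then have "6 * (x * y) \<le> 6 * y\<^sup>2 + 3/2 * x\<^sup>2" "2 * z \<le> 10 * z\<^sup>2 + 1/10"
    by (simp_all add: power2_eq_square algebra_simps)
  then show "4 * x ^ 3 + 6 * (x * y) + 2 * z \<le> 3461/1000"
    using area x2 x3 sq by linarith
  have "0 \<le> (2 * x\<^sup>2 - 3 * y)\<^sup>2" "0 \<le> 20 * (z - 3/20 * x)\<^sup>2" "0 \<le> 28 * (v - 1/28)\<^sup>2" by auto
  then have "12 * (x\<^sup>2 * y) \<le> 4 * x ^ 4 + 9 * y\<^sup>2" "6 * (x * z) \<le> 20 * z\<^sup>2 + 9/20 * x\<^sup>2" "2 * v \<le> 28 * v\<^sup>2 + 1/28"
    by (simp_all add: power2_eq_square power4_eq_xxxx algebra_simps)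
  then show "5 * x ^ 4 + 12 * (x\<^sup>2 * y) + 3 * y\<^sup>2 + 6 * (x * z) + 2 * v \<le> 4993/1000"
    using area x2 x4 sq by linarith
qed

lemma area_sum_7:
  fixes x :: "nat \<Rightarrow> real"
  shows "(\<Sum>m<7. (2 * real m - 3) * x m) = - 3 * x 0 - x 1 + x 2 + 3 * x 3 + 5 * x 4 + 7 * x 5 + 9 * x 6"
  by (simp add: numeral_eq_Suc)

lemma cmod_parallelogram: "2 * ((cmod u)\<^sup>2 + (cmod v)\<^sup>2) = (cmod (u - v))\<^sup>2 + (cmod (u + v))\<^sup>2"
  unfolding cmod_power2 by (simp add: power2_eq_square algebra_simps)

section \<open>The second coefficient of an inverse pair\<close>

lemma class_S_inverse_pair_fps:
  assumes f: "f \<in> class_S" and g: "g \<in> class_S" and inv: "\<forall>\<^sub>F z in nhds 0. g (f z) = z"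
  shows "fps_expansion g 0 oo fps_expansion f 0 = fps_X"
proof -
  have hf: "f has_fps_expansion fps_expansion f 0" and hg: "g has_fps_expansion fps_expansion g 0"
    by (simp_all add: holomorphic_ball_has_fps_expansion class_S_D(1)[OF f] class_S_D(1)[OF g])
  have "fps_nth (fps_expansion f 0) 0 = 0"
    using has_fps_expansion_imp_0_eq_fps_nth_0[OF hf] class_S_D(3)[OF f] by simp
  with hf hg have "(g \<circ> f) has_fps_expansion (fps_expansion g 0 oo fps_expansion f 0)"
    by (intro has_fps_expansion_compose)
  moreover have "(g \<circ> f) has_fps_expansion fps_X"
    using inv by (subst has_fps_expansion_cong[where g = "\<lambda>z. z" and G = fps_X]) (auto intro: fps_expansion_intros)
  ultimately show ?thesis by (rule fps_expansion_unique_complex)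
qed

lemma class_S_inverse_pair_coeff_neq:
  assumes f: "f \<in> class_S" and g: "g \<in> class_S" and inv: "\<forall>\<^sub>F z in nhds 0. g (f z) = z"
  shows "fps_nth (fps_expansion f 0) 2 \<noteq> 37/25"
proof
  assume a2: "fps_nth (fps_expansion f 0) 2 = 37/25"
  obtain \<sigma> where \<sigma>: "fps_nth \<sigma> 0 = 1" "fps_expansion f 0 = fps_X * \<sigma>\<^sup>2"
    "\<And>x1 x3. (\<Sum>m<7. (2 * real m - 3) *
       (cmod (fps_nth (fps_const x1 * fps_X * inverse \<sigma> + fps_const x3 * inverse \<sigma> ^ 3) m))\<^sup>2) \<le> 0"
    by (rule class_S_area_fps[OF f]) (rule that)
  obtain \<tau> where \<tau>: "fps_nth \<tau> 0 = 1" "fps_expansion g 0 = fps_X * \<tau>\<^sup>2"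
    "\<And>x1 x3. (\<Sum>m<7. (2 * real m - 3) *
       (cmod (fps_nth (fps_const x1 * fps_X * inverse \<tau> + fps_const x3 * inverse \<tau> ^ 3) m))\<^sup>2) \<le> 0"
    by (rule class_S_area_fps[OF g]) (rule that)
  have comp: "(fps_X * \<tau>\<^sup>2) oo (fps_X * \<sigma>\<^sup>2) = fps_X"
    using class_S_inverse_pair_fps[OF f g inv] by (simp add: \<sigma>(2) \<tau>(2))
  have p1: "fps_nth \<sigma> 1 = 37/50"
  proof -
    have "fps_nth (fps_X * \<sigma>\<^sup>2) (Suc 1) = fps_nth (\<sigma>\<^sup>2) 1"
      by simp
    also have "fps_nth (\<sigma>\<^sup>2) 1 = 2 * fps_nth \<sigma> 1"
      by (rule fps_power_nth_upto_6[OF \<sigma>(1) refl refl refl refl refl refl])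
    finally have "2 * fps_nth \<sigma> 1 = 37/25"
      using a2 unfolding \<sigma>(2) Suc_1 by (simp only:)
    then show ?thesis by (simp add: field_simps)
  qed
  \<comment> \<open>Coordinates adapted to the symmetry \<open>f(z) \<leftrightarrow> - g(- z)\<close>: it changes the signs of \<open>a\<close> and \<open>e\<close> and
    fixes \<open>g'\<close> and \<open>d\<close>.\<close>
  obtain a where p2: "fps_nth \<sigma> 2 = 4107/5000 + a"
    by (metis add_diff_cancel_left' diff_add_cancel add.commute)
  \<comment> \<open>Odd corrections to the even coordinates and even corrections to the odd ones are
    forced by the symmetry; the other terms only centre the coordinates. For instance, the constant
    4107/5000 in p2 is 3/2 times the square of 37/50.\<close>
  obtain g' where p3: "fps_nth \<sigma> 3 = 50653/62500 + 74/25 * a + g'"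
    by (metis add_diff_cancel_left' diff_add_cancel add.commute)
  obtain e where p4: "fps_nth \<sigma> 4 = 5622483/10000000 + 2738/625 * a + 5/2 * a\<^sup>2 + 37/10 * g' + e"
    by (metis add_diff_cancel_left' diff_add_cancel add.commute)
  obtain d where p5: "fps_nth \<sigma> 5 = 69343957/156250000 + 50653/25000 * a + 37/5 * a\<^sup>2 + 6 * a * g'
      + 1369/250 * g' + 111/25 * e + d"
    by (metis add_diff_cancel_left' diff_add_cancel add.commute)
  define A where "A = fps_const (1 + 3 * (37/50) * (3/10)) * fps_X * inverse \<sigma> + fps_const (3/10) * inverse \<sigma> ^ 3"
  define B where "B = fps_const (1 + 3 * (37/50) * (3/10)) * fps_X * inverse \<tau> - fps_const (3/10) * inverse \<tau> ^ 3"
  note A = area_fps_nth[OF \<sigma>(1) p1 p2 p3 p4 p5 refl A_def]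
  note B = area_fps_inverse_nth[OF \<sigma>(1) \<tau>(1) p1 p2 p3 p4 p5 refl comp B_def]
  define x y where "x m = (cmod (fps_nth A m))\<^sup>2" and "y m = (cmod (fps_nth B m))\<^sup>2" for m
  have xA: "- 3 * x 0 - x 1 + x 2 + 3 * x 3 + 5 * x 4 + 7 * x 5 + 9 * x 6 \<le> 0"
    using \<sigma>(3)[of "1 + 3 * (37/50) * (3/10)" "3/10"] unfolding A_def[symmetric] area_sum_7 x_def .
  have "B = fps_const (1 + 3 * (37/50) * (3/10)) * fps_X * inverse \<tau> + fps_const (- (3/10)) * inverse \<tau> ^ 3"
    unfolding B_def by (simp flip: fps_const_neg)
  then have yB: "- 3 * y 0 - y 1 + y 2 + 3 * y 3 + 5 * y 4 + 7 * y 5 + 9 * y 6 \<le> 0"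
    using \<tau>(3)[of "1 + 3 * (37/50) * (3/10)" "- (3/10)"] unfolding area_sum_7 y_def by (simp only:)
  have xy: "x 0 = 9/100" "x 1 = 1" "y 0 = 9/100" "y 1 = 1"
    unfolding x_def y_def A(1,2) B(1,2) by (simp_all add: power2_eq_square norm_divide)
  \<comment> \<open>The symmetry exchanges the m-th coefficients of \<open>A\<close> and
    \<open>B\<close> up to the sign (-1)^(m+1). Hence exactly one of the sum and the difference is
    even under it: the difference for even m, the sum for odd m.\<close>
  define s t where "s m = (cmod (fps_nth A m - fps_nth B m))\<^sup>2" and "t m = (cmod (fps_nth A m + fps_nth B m))\<^sup>2" for m
  have st: "2 * (x m + y m) = s m + t m" for m
    unfolding x_def y_def s_def t_def by (rule cmod_parallelogram)
  have nonneg: "0 \<le> s m" "0 \<le> t m" for m by (simp_all add: s_def t_def)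
  have "s 2 = (49321/25000)\<^sup>2"
  proof -
    have "fps_nth A 2 - fps_nth B 2 = - (49321/25000)"
      unfolding A B by algebra
    then show ?thesis by (simp add: s_def norm_divide)
  qed
  moreover have "t 3 = (cmod (532541/1250000 + 9/5 * g'))\<^sup>2"
  proof -
    have "fps_nth A 3 + fps_nth B 3 = - (532541/1250000 + 9/5 * g')"
      unfolding A B by algebra
    then show ?thesis by (simp only: t_def norm_minus_cancel)
  qed
  moreover have "s 3 = (cmod (833/250 * a))\<^sup>2"
  proof -
    have "fps_nth A 3 - fps_nth B 3 = - (833/250 * a)"
      unfolding A B by algebra
    then show ?thesis by (simp only: s_def norm_minus_cancel)
  qed
  moreover have "s 4 = (cmod (16867449/50000000 - 583/125 * g' - 9/10 * a\<^sup>2))\<^sup>2"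
  proof -
    have "fps_nth A 4 - fps_nth B 4 = 16867449/50000000 - 583/125 * g' - 9/10 * a\<^sup>2"
      unfolding A B by algebra
    then show ?thesis by (simp only: s_def)
  qed
  moreover have "t 4 = (cmod (6179/6250 * a + 9/5 * e))\<^sup>2"
  proof -
    have "fps_nth A 4 + fps_nth B 4 = - (6179/6250 * a + 9/5 * e)"
      unfolding A B by algebra
    then show ?thesis by (simp only: t_def norm_minus_cancel)
  qed
  moreover have "t 5 = (cmod (942702983/12500000000 - 18537/12500 * g' + 1497/500 * a\<^sup>2 - 9/5 * d))\<^sup>2"
  proof -
    have "fps_nth A 5 + fps_nth B 5 = 942702983/12500000000 - 18537/12500 * g' + 1497/500 * a\<^sup>2 - 9/5 * d"
      unfolding A B by algebra
    then show ?thesis by (simp only: t_def)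
  qed
  moreover have "s 6 = (cmod (- (561894083571/250000000000) + 19602711/1250000 * g' - 27/10 * g'\<^sup>2
           + 1515483/50000 * a\<^sup>2 - 27/5 * (a * e) - 916/125 * d))\<^sup>2"
  proof -
    have "fps_nth A 6 - fps_nth B 6 = - (561894083571/250000000000) + 19602711/1250000 * g' - 27/10 * g'\<^sup>2
           + 1515483/50000 * a\<^sup>2 - 27/5 * (a * e) - 916/125 * d"
      unfolding A B by algebra
    then show ?thesis by (simp only: s_def)
  qed
  ultimately have "127/25 < s 2 + 3 * (t 3 + s 3) + 5 * (s 4 + t 4) + 7 * t 5 + 9 * s 6"
    using area_certificate[of g' a e d] by simp
  \<comment> \<open>The bound is 4 (1 + 3 * 9/100): the terms with negative weight from both
    inequalities, doubled by the parallelogram law. The discarded squares \<open>t 2\<close>,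
    \<open>s 5\<close> and \<open>t 6\<close> belong to odd combinations, which vanish on symmetric
    pairs.\<close>
  moreover have "s 2 + 3 * (t 3 + s 3) + 5 * (s 4 + t 4) + 7 * t 5 + 9 * s 6 \<le> 127/25"
    using xA yB xy st[of 2] st[of 3] st[of 4] st[of 5] st[of 6] nonneg(2)[of 2] nonneg(1)[of 5] nonneg(2)[of 6]
    by argo
  ultimately show False by simp
qed

lemma class_S_scale:
  assumes f: "f \<in> class_S" and c: "c \<noteq> 0" "cmod c \<le> 1"
  shows "(\<lambda>z. f (c * z) / c) \<in> class_S"
    and "fps_nth (fps_expansion (\<lambda>z. f (c * z) / c) 0) 2 = c * fps_nth (fps_expansion f 0) 2"
proof -
  have cz: "c * z \<in> ball 0 1" if "z \<in> ball 0 1" for z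
    using c that mult_le_one[of "cmod c" "cmod z"] mult_left_le_one_le[of "cmod z" "cmod c"] by (simp add: norm_mult)
  have hol: "(\<lambda>z. f (c * z) / c) holomorphic_on ball 0 1"
  proof -
    have "(f \<circ> (\<lambda>z. c * z)) holomorphic_on ball 0 1"
      by (rule holomorphic_on_compose_gen[OF _ class_S_D(1)[OF f]]) (use cz in \<open>auto intro!: holomorphic_intros\<close>)
    then show ?thesis using c by (auto intro!: holomorphic_intros simp: o_def)
  qed
  have "inj_on (\<lambda>z. f (c * z) / c) (ball 0 1)"
    using class_S_D(2)[OF f] cz c unfolding inj_on_def by (metis divide_cancel_right mult_left_cancel)
  define F where "F = fps_expansion f 0"
  have hf: "f has_fps_expansion F"
    unfolding F_def by (rule holomorphic_ball_has_fps_expansion[OF class_S_D(1)[OF f]])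
  have "(f \<circ> (\<lambda>z. c * z)) has_fps_expansion (F oo (fps_const c * fps_X))"
    by (intro has_fps_expansion_compose hf fps_expansion_intros) simp
  then have "(\<lambda>z. inverse c * (f \<circ> (\<lambda>z. c * z)) z) has_fps_expansion fps_const (inverse c) * (F oo (fps_const c * fps_X))"
    by (rule has_fps_expansion_cmult_left)
  then have h: "(\<lambda>z. f (c * z) / c) has_fps_expansion fps_const (inverse c) * (F oo (fps_const c * fps_X))"
    by (simp add: o_def divide_inverse mult.commute)
  have "deriv (\<lambda>z. f (c * z) / c) 0 = fps_nth (fps_const (inverse c) * (F oo (fps_const c * fps_X))) 1"
    using fps_nth_fps_expansion[OF h, of 1] by simp
  also have "\<dots> = fps_nth F 1"
    using c by (simp add: fps_compose_linear)
  also have "\<dots> = 1"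
    using fps_nth_fps_expansion[OF hf, of 1] class_S_D(4)[OF f] by simp
  finally have "deriv (\<lambda>z. f (c * z) / c) 0 = 1" .
  then show "(\<lambda>z. f (c * z) / c) \<in> class_S"
    using hol \<open>inj_on _ _\<close> class_S_D(3)[OF f] by (simp add: class_S_def univalent_on_def)
  show "fps_nth (fps_expansion (\<lambda>z. f (c * z) / c) 0) 2 = c * fps_nth (fps_expansion f 0) 2"
    unfolding fps_expansion_eqI[OF h] F_def[symmetric] using c by (simp add: fps_compose_linear power2_eq_square)
qed

lemma class_S_inverse_pair_coeff_bound:
  assumes f: "f \<in> class_S" and g: "g \<in> class_S" and inv: "\<forall>\<^sub>F z in nhds 0. g (f z) = z"
  shows "cmod (fps_nth (fps_expansion f 0) 2) \<le> 37/25"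
proof (rule ccontr)
  assume neg: "\<not> ?thesis"
  define a where "a = fps_nth (fps_expansion f 0) 2"
  \<comment> \<open>As c is complex, the rescaling also rotates the coefficient onto the positive
    real axis.\<close>
  define c where "c = 37/25 / a"
  have a: "cmod a > 37/25" using neg by (simp add: a_def)
  then have c: "c \<noteq> 0" "cmod c \<le> 1" "c * a = 37/25"
    by (auto simp: c_def norm_divide divide_le_eq)
  have "isCont (\<lambda>z. c * z) 0" by simp
  then have "filterlim (\<lambda>z. c * z) (nhds 0) (nhds 0)"
    using tendsto_at_iff_tendsto_nhds[of "\<lambda>z. c * z" 0] by (simp add: isCont_def)
  from eventually_compose_filterlim[OF inv this]
  have "\<forall>\<^sub>F z in nhds 0. g (f (c * z)) = c * z" .
  then have "\<forall>\<^sub>F z in nhds 0. g (c * (f (c * z) / c)) / c = z"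
    by eventually_elim (use c in simp)
  from class_S_inverse_pair_coeff_neq[OF class_S_scale(1)[OF f c(1,2)] class_S_scale(1)[OF g c(1,2)] this]
  show False
    using c(3) by (simp add: class_S_scale(2)[OF f c(1,2)] a_def)
qed

text \<open>The definition of the class does not normalize g. Both g(0) = 0 and g'(0) = 1 follow
  from g(f(z)) = z near 0, so that g lies in \<open>class_S\<close> too.\<close>

lemma class_Sb_coeff_2_bound:
  assumes "f \<in> class_Sb"
  shows "f \<in> class_S" "cmod (fps_nth (fps_expansion f 0) 2) \<le> 37/25"
proof -
  from assms obtain g where f: "f \<in> class_S" and g: "univalent_on g (ball 0 1)"
    and ginv: "\<forall>\<^sub>F w in nhds 0. g w = inv_into (ball 0 1) f w"
    by (auto simp: class_Sb_def)
  show "f \<in> class_S" by fact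
  have "isCont f 0"
    using class_S_D(1)[OF f] by (intro continuous_on_interior[of "ball 0 1"] holomorphic_on_imp_continuous_on) auto
  then have "filterlim f (nhds 0) (nhds 0)"
    using class_S_D(3)[OF f] by (metis isCont_def tendsto_at_iff_tendsto_nhds)
  from eventually_compose_filterlim[OF ginv this]
  have "\<forall>\<^sub>F z in nhds 0. g (f z) = inv_into (ball 0 1) f (f z)" .
  moreover have "\<forall>\<^sub>F z::complex in nhds 0. z \<in> ball 0 1"
    by (intro eventually_nhds_in_open) auto
  ultimately have inv: "\<forall>\<^sub>F z in nhds 0. g (f z) = z"
    by eventually_elim (simp add: inv_into_f_f[OF class_S_D(2)[OF f]])
  from eventually_nhds_x_imp_x[OF inv] have g0: "g 0 = 0"
    using class_S_D(3)[OF f] by simp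
  have holg: "g holomorphic_on ball 0 1" using g by (simp add: univalent_on_def)
  have "(f has_field_derivative 1) (at 0)"
    using holomorphic_derivI[OF class_S_D(1)[OF f], of 0] class_S_D(4)[OF f] by simp
  moreover have "(g has_field_derivative deriv g 0) (at (f 0))"
    using holomorphic_derivI[OF holg, of 0] class_S_D(3)[OF f] by simp
  ultimately have "((\<lambda>z. g (f z)) has_field_derivative deriv g 0 * 1) (at 0)"
    by (rule DERIV_chain2[rotated])
  moreover have "((\<lambda>z. g (f z)) has_field_derivative 1) (at 0)"
    using inv by (subst DERIV_cong_ev[OF refl _ refl, where g = "\<lambda>z. z"]) auto
  ultimately have "deriv g 0 = 1"
    using DERIV_unique by fastforce
  then have "g \<in> class_S"
    using g g0 by (simp add: class_S_def)
  from class_S_inverse_pair_coeff_bound[OF f this inv]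
  show "cmod (fps_nth (fps_expansion f 0) 2) \<le> 37/25" .
qed

section \<open>The third, fourth and fifth coefficients\<close>

lemma class_S_coeff_bounds:
  assumes f: "f \<in> class_S" and a2: "cmod (fps_nth (fps_expansion f 0) 2) \<le> 37/25"
  shows "cmod (fps_nth (fps_expansion f 0) 3) \<le> 2427/1000"
    and "cmod (fps_nth (fps_expansion f 0) 4) \<le> 3461/1000"
    and "cmod (fps_nth (fps_expansion f 0) 5) \<le> 4993/1000"
proof -
  obtain \<sigma> where \<sigma>: "fps_nth \<sigma> 0 = 1" "fps_expansion f 0 = fps_X * \<sigma>\<^sup>2"
    "\<And>x1 x3. (\<Sum>m<7. (2 * real m - 3) *
       (cmod (fps_nth (fps_const x1 * fps_X * inverse \<sigma> + fps_const x3 * inverse \<sigma> ^ 3) m))\<^sup>2) \<le> 0"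
    by (rule class_S_area_fps[OF f]) (rule that)
  define p where "p = fps_nth \<sigma>"
  \<comment> \<open>The case m = 0, where A is X divided by the square root series; the vanishing
    summands are kept so that \<open>area_fps_nth\<close> and the area inequality match
    literally.\<close>
  define A where "A = fps_const (1 + 3 * p 1 * 0) * fps_X * inverse \<sigma> + fps_const 0 * inverse \<sigma> ^ 3"
  note A = area_fps_nth[OF \<sigma>(1) refl refl refl refl refl refl A_def[unfolded p_def], folded p_def]
  note s2 = fps_power_nth_upto_6[OF \<sigma>(1) refl refl refl refl refl refl, folded p_def]
  \<comment> \<open>The subscripts are the weights in the area inequality. With 1/s = 1 + u1 z + u3
    z^2 + ..., the coefficient formulas below expand f = z (1 + u1 z + u3 z^2 + ...)^(-2).\<close>
  define u1 u3 u5 u7 where "u1 = fps_nth A 2" and "u3 = fps_nth A 3" and "u5 = fps_nth A 4" and "u7 = fps_nth A 5"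
  have "- 3 * (cmod (fps_nth A 0))\<^sup>2 - (cmod (fps_nth A 1))\<^sup>2 + (cmod u1)\<^sup>2 + 3 * (cmod u3)\<^sup>2
      + 5 * (cmod u5)\<^sup>2 + 7 * (cmod u7)\<^sup>2 + 9 * (cmod (fps_nth A 6))\<^sup>2 \<le> 0"
    unfolding u1_def u3_def u5_def u7_def area_sum_7[of "\<lambda>m. (cmod (fps_nth A m))\<^sup>2", symmetric]
    unfolding A_def by (rule \<sigma>(3))
  then have area: "(cmod u1)\<^sup>2 + 3 * (cmod u3)\<^sup>2 + 5 * (cmod u5)\<^sup>2 + 7 * (cmod u7)\<^sup>2 \<le> 1"
    using zero_le_power2[of "cmod (fps_nth A 6)"]
    unfolding A(1,2) norm_zero norm_one power_zero_numeral power_one by linarith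
  have nth: "fps_nth (fps_expansion f 0) (Suc n) = fps_nth (\<sigma>\<^sup>2) n" for n
    by (simp add: \<sigma>(2))
  have c2: "fps_nth (fps_expansion f 0) 2 = - 2 * u1"
    using nth[of 1] unfolding Suc_1 s2 u1_def A by simp
  have c3: "fps_nth (fps_expansion f 0) 3 = 3 * u1\<^sup>2 - 2 * u3"
    using nth[of 2] by (simp add: s2 u1_def u3_def A)
  have c4: "fps_nth (fps_expansion f 0) 4 = - 4 * u1 ^ 3 + 6 * (u1 * u3) - 2 * u5"
  proof -
    have "fps_nth (fps_expansion f 0) 4 = 2 * p 3 + 2 * p 1 * p 2"
      using nth[of 3] by (simp add: s2)
    also have "\<dots> = - 4 * u1 ^ 3 + 6 * (u1 * u3) - 2 * u5"
      unfolding u1_def u3_def u5_def A by algebra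
    finally show ?thesis .
  qed
  have c5: "fps_nth (fps_expansion f 0) 5 = 5 * u1 ^ 4 - 12 * (u1\<^sup>2 * u3) + 3 * u3\<^sup>2 + 6 * (u1 * u5) - 2 * u7"
  proof -
    have "fps_nth (fps_expansion f 0) 5 = (p 2)\<^sup>2 + 2 * p 4 + 2 * p 1 * p 3"
      using nth[of 4] by (simp add: s2)
    also have "\<dots> = 5 * u1 ^ 4 - 12 * (u1\<^sup>2 * u3) + 3 * u3\<^sup>2 + 6 * (u1 * u5) - 2 * u7"
      unfolding u1_def u3_def u5_def u7_def A by algebra
    finally show ?thesis .
  qed
  have u1: "cmod u1 \<le> 37/50"
    using a2 by (simp add: c2 norm_mult)
  note bounds = real_coefficient_bounds[OF norm_ge_zero u1 area]
  have "cmod (3 * u1\<^sup>2 - 2 * u3) \<le> 3 * (cmod u1)\<^sup>2 + 2 * cmod u3"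
    by (rule order_trans[OF norm_triangle_ineq4]) (simp add: norm_mult norm_power)
  then show "cmod (fps_nth (fps_expansion f 0) 3) \<le> 2427/1000"
    using bounds(1) by (simp add: c3)
  have "cmod (- 4 * u1 ^ 3 + 6 * (u1 * u3) - 2 * u5)
      \<le> cmod (- 4 * u1 ^ 3) + cmod (6 * (u1 * u3)) + cmod (2 * u5)"
    by (meson add_mono norm_triangle_ineq norm_triangle_ineq4 order_refl order_trans)
  then show "cmod (fps_nth (fps_expansion f 0) 4) \<le> 3461/1000"
    using bounds(2) unfolding c4 by (simp add: norm_mult norm_power)
  have "cmod (5 * u1 ^ 4 - 12 * (u1\<^sup>2 * u3) + 3 * u3\<^sup>2 + 6 * (u1 * u5) - 2 * u7)
      \<le> cmod (5 * u1 ^ 4) + cmod (12 * (u1\<^sup>2 * u3)) + cmod (3 * u3\<^sup>2) + cmod (6 * (u1 * u5)) + cmod (2 * u7)"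
    by (meson add_mono norm_triangle_ineq norm_triangle_ineq4 order_refl order_trans)
  then show "cmod (fps_nth (fps_expansion f 0) 5) \<le> 4993/1000"
    using bounds(3) unfolding c5 by (simp add: norm_mult norm_power)
qed

theorem theorem1:
  shows "\<exists>(c3::real) (c4::real) (c5::real).
           c3 \<in> {2.427..<2.428} \<and> c4 \<in> {3.461..<3.462} \<and> c5 \<in> {4.993..<4.994} \<and>
           (\<forall>f \<in> class_Sb.
              cmod (fps_nth (fps_expansion f 0) 3) \<le> c3 \<and>
              cmod (fps_nth (fps_expansion f 0) 4) \<le> c4 \<and>
              cmod (fps_nth (fps_expansion f 0) 5) \<le> c5)"
proof (intro exI conjI ballI)
  fix f assume "f \<in> class_Sb"
  note f = class_Sb_coeff_2_bound[OF this]
  \<comment> \<open>The witnesses are the left endpoints of the three prescribed intervals.\<close>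
  show "cmod (fps_nth (fps_expansion f 0) 3) \<le> 2427/1000"
    "cmod (fps_nth (fps_expansion f 0) 4) \<le> 3461/1000"
    "cmod (fps_nth (fps_expansion f 0) 5) \<le> 4993/1000"
    by (rule class_S_coeff_bounds[OF f])+
qed auto

end
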